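(* Let $\mathscr D=([n],\mathcal J)$ be a nondegenerate discrete polymatroid, let $\omega:[n]\to\mathbb R_{>0}$ be a positive weight function, and let $1\le k<\mathrm{rk}(\mathscr D)$. Then $$\mathrm J_{\omega}(k)^2\ =\ \Bigl(1+\frac1k\Bigr)\,\mathrm J_{\omega}(k-1)\,\mathrm J_{\omega}(k+1)$$ if and only if $\mathrm{polygirth}(\mathscr D)>k+1$.
   Context: A discrete polymatroid $\mathscr D=([n],\mathcal J)$ consists of $[n]=\{1,\dots,n\}$ and a nonempty finite set $\mathcal J\subset\mathbb N^n$ (with $0\in\mathbb N$) such that: (hereditary) $a\in\mathcal J$, $b\in\mathbb N^n$, $b\le a$ componentwise imply $b\in\mathcal J$; (exchange) $a,b\in\mathcal J$, $|a|<|b|$ imply there is $i\in[n]$ with $a_i<b_i$ and $a+e_i\in\mathcal J$. Here $|a|=a_1+\dots+a_n$ and $e_1,\dots,e_n$ is the standard basis. $\mathrm{rk}(\mathscr D)=\max\{|a|:a\in\mathcal J\}$, $\mathcal J_k=\{a\in\mathcal J:|a|=k\}$, $\mathrm J(k)=|\mathcal J_k|$. $\mathscr D$ is nondegenerate if $e_i\in\mathcal J$ for every $i\in[n]$. Define $\mathrm{polygirth}(\mathscr D)=\min\{k:\mathrm J(k)<\binom{n+k-1}{k}\}$; thus every $a\in\mathbb N^n$ with $|a|<\mathrm{polygirth}(\mathscr D)$ lies in $\mathcal J$. Put $\omega(a)=\prod_i\omega(i)^{a_i}$, $a!=\prod_i a_i!$, and $\mathrm J_\omega(k)=\sum_{a\in\mathcal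 J_k}\omega(a)/a!$. *)

theory Defs
  imports Complex_Main
begin

text \<open>
  The ground set is \<open>[n] = {1..n}\<close>.  A vector of \<open>\<nat>\<^sup>n\<close> is a function on \<open>nat\<close> vanishing
  outside \<open>{1..n}\<close>, so that vectors are equal iff their \<open>n\<close> coordinates agree, and the
  componentwise order is the pointwise order on functions.
\<close>

definition nvecs :: "nat \<Rightarrow> (nat \<Rightarrow> nat) set" where
  "nvecs n = {a. \<forall>i. i \<notin> {1..n} \<longrightarrow> a i = 0}"

definition vsize :: "nat \<Rightarrow> (nat \<Rightarrow> nat) \<Rightarrow> nat" where
  "vsize n a = (\<Sum>i\<in>{1..n}. a i)"

definition unit_vec :: "nat \<Rightarrow> nat \<Rightarrow> nat" where
  "unit_vec i = (\<lambda>j. if j = i then 1 else 0)"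

definition vadd :: "(nat \<Rightarrow> nat) \<Rightarrow> (nat \<Rightarrow> nat) \<Rightarrow> nat \<Rightarrow> nat" where
  "vadd a b = (\<lambda>j. a j + b j)"

locale discrete_polymatroid =
  fixes n :: nat and J :: "(nat \<Rightarrow> nat) set"
  assumes vectors: "J \<subseteq> nvecs n"
    and finite: "finite J"
    and nonempty: "J \<noteq> {}"
    and hereditary: "\<lbrakk>a \<in> J; b \<in> nvecs n; b \<le> a\<rbrakk> \<Longrightarrow> b \<in> J"
    and exchange: "\<lbrakk>a \<in> J; b \<in> J; vsize n a < vsize n b\<rbrakk>
      \<Longrightarrow> \<exists>i\<in>{1..n}. a i < b i \<and> vadd a (unit_vec i) \<in> J"

definition nondegenerate :: "nat \<Rightarrow> (nat \<Rightarrow> nat) set \<Rightarrow> bool" where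
  "nondegenerate n J \<longleftrightarrow> (\<forall>i\<in>{1..n}. unit_vec i \<in> J)"

definition polymatroid_rank :: "nat \<Rightarrow> (nat \<Rightarrow> nat) set \<Rightarrow> nat" where
  "polymatroid_rank n J = Max (vsize n ` J)"

definition level :: "nat \<Rightarrow> (nat \<Rightarrow> nat) set \<Rightarrow> nat \<Rightarrow> (nat \<Rightarrow> nat) set" where
  "level n J k = {a \<in> J. vsize n a = k}"

text \<open>
  For \<open>n \<ge> 1\<close> and finite \<open>J\<close> the minimum exists, since all large levels are empty.
  For \<open>n = 0\<close> no such \<open>k\<close> exists and the value is unspecified; this degenerate case
  has rank 0.
\<close>

definition polygirth :: "nat \<Rightarrow> (nat \<Rightarrow> nat) set \<Rightarrow> nat" where
  "polygirth n J = (LEAST k. card (level n J k) < (n + k - 1) choose k)"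

definition vweight :: "nat \<Rightarrow> (nat \<Rightarrow> real) \<Rightarrow> (nat \<Rightarrow> nat) \<Rightarrow> real" where
  "vweight n \<omega> a = (\<Prod>i\<in>{1..n}. \<omega> i ^ a i)"

definition vfact :: "nat \<Rightarrow> (nat \<Rightarrow> nat) \<Rightarrow> real" where
  "vfact n a = (\<Prod>i\<in>{1..n}. fact (a i))"

definition weighted_level ::
  "nat \<Rightarrow> (nat \<Rightarrow> nat) set \<Rightarrow> (nat \<Rightarrow> real) \<Rightarrow> nat \<Rightarrow> real" where
  "weighted_level n J \<omega> k = (\<Sum>a\<in>level n J k. vweight n \<omega> a / vfact n a)"

end

theory Submission
  imports Defs "HOL-Analysis.Function_Topology"
begin

text \<open>
  Write \<open>N(m)\<close> for \<open>m! J\<^sub>\<omega>(m)\<close>, the total weight of the words of length \<open>m\<close> whose content lies in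
  \<open>J\<close>, so that the equation reads \<open>N(k)\<^sup>2 = N(k-1) N(k+1)\<close>. Adjoin a free element \<open>0\<close> of weight \<open>0\<close>
  and let \<open>H\<close> be the matrix, indexed by \<open>{0..n}\<close>, whose \<open>(i,j)\<close> entry is \<open>N(k-1)\<close> of the contraction
  at \<open>e\<^sub>i + e\<^sub>j\<close>. With \<open>p = (0, \<omega>)\<close>, the values of the quadratic form at \<open>(e\<^sub>0,e\<^sub>0)\<close>, \<open>(e\<^sub>0,p)\<close>, \<open>(p,p)\<close>
  are \<open>N(k-1)\<close>, \<open>N(k)\<close>, \<open>N(k+1)\<close>.
  The matrix \<open>H\<close> is the \<open>p\<close>-weighted sum of the matrices of the contractions, and by induction
  (Perron-Frobenius plus a Bochner-type inequality for positive weights, then a limit) it has at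
  most one positive eigenvalue. Equality therefore forces \<open>H z = 0\<close> for some \<open>z = e\<^sub>0 - c p\<close>, and
  the induction pushes this kernel vector down to the contraction at every \<open>a \<in> J\<close> with
  \<open>|a| = k - 1\<close>. There it says that every element that can be added to \<open>a\<close> can still be added
  afterwards, and that the set \<open>S(a)\<close> of these elements has a weight independent of \<open>a\<close>; exchange
  and nondegeneracy then give \<open>S(a) = [n]\<close> for all \<open>a\<close>.
\<close>

section \<open>Hyperbolic quadratic forms\<close>

definition bform :: "'a set \<Rightarrow> ('a \<Rightarrow> 'a \<Rightarrow> real) \<Rightarrow> ('a \<Rightarrow> real) \<Rightarrow> ('a \<Rightarrow> real) \<Rightarrow> real" where
  "bform E M x y = (\<Sum>i\<in>E. x i * (\<Sum>j\<in>E. M i j * y j))"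

text \<open>For symmetric \<open>M\<close> this reversed Cauchy-Schwarz inequality expresses that
  there is at most one positive eigenvalue. Stated without eigenvalues, it passes to limits of the
  entries.\<close>

definition hyperbolic_on :: "'a set \<Rightarrow> ('a \<Rightarrow> 'a \<Rightarrow> real) \<Rightarrow> bool" where
  "hyperbolic_on E M \<longleftrightarrow>
     (\<forall>x y. bform E M y y > 0 \<longrightarrow> bform E M x x * bform E M y y \<le> (bform E M x y)\<^sup>2)"

lemma bform_sym:
  assumes "\<And>i j. M i j = M j i"
  shows "bform E M x y = bform E M y x"
proof -
  have "bform E M x y = (\<Sum>i\<in>E. \<Sum>j\<in>E. x i * M i j * y j)"
    by (simp add: bform_def sum_distrib_left mult.assoc)
  also have "\<dots> = (\<Sum>j\<in>E. \<Sum>i\<in>E. x i * M i j * y j)"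
    by (rule sum.swap)
  also have "\<dots> = bform E M y x"
    unfolding bform_def sum_distrib_left
    by (intro sum.cong refl) (simp add: assms[of _ "_"] mult_ac)
  finally show ?thesis .
qed

lemma bform_add_left:
  "bform E M (\<lambda>i. x i + t * y i) z = bform E M x z + t * bform E M y z"
  by (simp add: bform_def sum.distrib sum_distrib_left algebra_simps)

lemma bform_add_right:
  "bform E M z (\<lambda>i. x i + t * y i) = bform E M z x + t * bform E M z y"
  by (simp add: bform_def sum.distrib sum_distrib_left algebra_simps)

lemma bform_scale: "bform E M (\<lambda>i. t * x i) (\<lambda>i. t * x i) = t\<^sup>2 * bform E M x x"
  by (simp add: bform_def sum_distrib_left power2_eq_square algebra_simps)

lemma bform_add_square:
  assumes "\<And>i j. M i j = M j i"
  shows "bform E M (\<lambda>i. x i + t * y i) (\<lambda>i. x i + t * y i) =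
    bform E M x x + 2 * t * bform E M x y + t\<^sup>2 * bform E M y y"
  using bform_sym[of M E y x, OF assms]
  by (simp add: bform_add_left bform_add_right power2_eq_square algebra_simps)

text \<open>Adding a multiple of \<open>y\<close> moves \<open>x\<close> into the kernel of
  \<open>f\<close>, where the form is nonpositive; multiplying by the value at \<open>y\<close> and
  completing the square gives the inequality.\<close>

lemma hyperbolic_onI:
  assumes sym: "\<And>i j. M i j = M j i"
    and lin: "\<And>x y t. f (\<lambda>i. x i + t * y i) = f x + t * (f y :: real)"
    and neg: "\<And>x. f x = 0 \<Longrightarrow> bform E M x x \<le> 0"
  shows "hyperbolic_on E M"
  unfolding hyperbolic_on_def
proof (intro allI impI)
  fix x y assume pos: "bform E M y y > 0"
  then have ne: "f y \<noteq> 0" using neg[of y] by auto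
  define t where "t = - f x / f y"
  have "f (\<lambda>i. x i + t * y i) = 0"
    unfolding lin using ne by (simp add: t_def)
  then have "bform E M x x + 2 * t * bform E M x y + t\<^sup>2 * bform E M y y \<le> 0"
    using neg bform_add_square[of M E x t y, OF sym] by metis
  then have "(bform E M x x + 2 * t * bform E M x y + t\<^sup>2 * bform E M y y) * bform E M y y \<le> 0"
    using pos by (simp add: mult_nonpos_nonneg)
  moreover have "(bform E M x y + t * bform E M y y)\<^sup>2 \<ge> 0" by simp
  ultimately show "bform E M x x * bform E M y y \<le> (bform E M x y)\<^sup>2"
    by (simp add: power2_eq_square algebra_simps)
qed

text \<open>For small \<open>t\<close> of the sign of \<open>b\<close> the linear term dominates.
  This is the first-order condition in the variational arguments below.\<close>

lemma linear_le_quadratic_imp_zero: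
  fixes b c :: real
  assumes "\<And>t. 2 * t * b + t\<^sup>2 * c \<le> 0"
  shows "b = 0"
proof (rule ccontr)
  assume "b \<noteq> 0"
  define t where "t = b / (\<bar>c\<bar> + 1)"
  have "0 < \<bar>c\<bar> + 1" by simp
  then have bt: "b = t * (\<bar>c\<bar> + 1)" by (simp add: t_def)
  with \<open>b \<noteq> 0\<close> have "t\<^sup>2 > 0" by auto
  have "2 * t * b + t\<^sup>2 * c = t\<^sup>2 * (2 * \<bar>c\<bar> + 2 + c)"
    by (subst bt) (simp add: power2_eq_square algebra_simps)
  moreover have "2 * \<bar>c\<bar> + 2 + c > 0" by linarith
  ultimately show False using assms[of t] \<open>t\<^sup>2 > 0\<close>
    by (metis mult_pos_pos not_less)
qed

text \<open>The form is nonpositive on the orthogonal complement of \<open>p\<close>, so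
  \<open>z\<close> maximises it there with value 0, and its derivative along the complement
  vanishes. The direction \<open>p\<close> is covered by \<open>orth\<close>.\<close>

lemma hyperbolic_on_null:
  assumes sym: "\<And>i j. M i j = M j i" and hyp: "hyperbolic_on E M"
    and pos: "bform E M p p > 0" and orth: "bform E M z p = 0" and null: "bform E M z z = 0"
  shows "bform E M z y = 0"
proof -
  have neg: "bform E M x x \<le> 0" if "bform E M x p = 0" for x
  proof -
    have "bform E M x x * bform E M p p \<le> 0"
      using hyp pos that unfolding hyperbolic_on_def by (metis zero_power2)
    then show ?thesis using pos by (simp add: mult_le_0_iff)
  qed
  define s where "s = - bform E M y p / bform E M p p"
  define u where "u = (\<lambda>i. y i + s * p i)"
  have u0: "bform E M u p = 0"
    unfolding u_def bform_add_left using pos by (simp add: s_def)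
  have "2 * t * bform E M z u + t\<^sup>2 * bform E M u u \<le> 0" for t
  proof -
    have "bform E M (\<lambda>i. z i + t * u i) p = 0" by (simp add: bform_add_left orth u0)
    from neg[OF this] show ?thesis by (simp add: bform_add_square[of M, OF sym] null)
  qed
  then have "bform E M z u = 0" by (rule linear_le_quadratic_imp_zero)
  then show ?thesis by (simp add: u_def bform_add_right orth)
qed

section \<open>A Perron-Frobenius criterion for nonpositivity\<close>

lemma compact_box_fun: "compact (PiE UNIV (\<lambda>i. {a i..b i :: real}))"
proof -
  have "compactin (product_topology (\<lambda>i. euclidean) UNIV) (PiE UNIV (\<lambda>i. {a i..b i}))"
    by (subst compactin_PiE) auto
  then show ?thesis by (simp add: euclidean_product_topology)
qed

text \<open>Relative to the diagonal weights \<open>r i / p i\<close>, the vector \<open>p\<close>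
  is an eigenvector of \<open>M\<close> with eigenvalue 1, and \<open>le\<close> forces every
  positive eigenvalue to be at least 1. Perron-Frobenius with \<open>conn\<close> makes 1 the
  largest eigenvalue and simple, so no positive eigenvalue is left on the complement of
  \<open>p\<close>.\<close>

lemma perron_form_nonpos:
  fixes M :: "'a \<Rightarrow> 'a \<Rightarrow> real"
  assumes fin: "finite S" and sym: "\<And>i j. M i j = M j i" and nonneg: "\<And>i j. M i j \<ge> 0"
    and p: "\<And>i. i \<in> S \<Longrightarrow> p i > 0"
    and r: "\<And>i. i \<in> S \<Longrightarrow> r i = (\<Sum>j\<in>S. M i j * p j)" and rpos: "\<And>i. i \<in> S \<Longrightarrow> r i > 0"
    and le: "\<And>x. bform S M x x \<le> (\<Sum>i\<in>S. p i * (\<Sum>j\<in>S. M i j * x j)\<^sup>2 / r i)"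
    and conn: "\<And>i j. i \<in> S \<Longrightarrow> j \<in> S \<Longrightarrow> M i j > 0 \<or> (\<exists>l\<in>S. M i l > 0 \<and> M l j > 0)"
    and orth: "bform S M w p = 0"
  shows "bform S M w w \<le> 0"
proof (rule ccontr)
  assume "\<not> bform S M w w \<le> 0"
  then have wpos: "bform S M w w > 0" by simp
  define d where "d i = r i / p i" for i
  have dpos: "d i > 0" if "i \<in> S" for i using p[OF that] rpos[OF that] by (simp add: d_def)
  define q where "q x = (\<Sum>i\<in>S. d i * (x i)\<^sup>2)" for x
  \<comment> \<open>The linear condition is orthogonality to \<open>p\<close>, both for the form of
    \<open>M\<close> and for the weights \<open>d\<close>.\<close>
  define Z where "Z = {x. (\<forall>i. i \<notin> S \<longrightarrow> x i = 0) \<and> (\<Sum>i\<in>S. r i * x i) = 0}"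
  define K where "K = {x \<in> Z. q x = 1}"
  have row: "bform S M x p = (\<Sum>i\<in>S. r i * x i)" for x
    unfolding bform_def by (intro sum.cong refl) (simp add: r mult.commute)
  have cont: "continuous_on UNIV (\<lambda>x :: 'a \<Rightarrow> real. x i)" for i
    by (rule continuous_on_product_coordinates)
  note cint = continuous_intros continuous_on_subset[OF cont subset_UNIV]
  have contB: "continuous_on A (\<lambda>x. bform S M x x)" for A
    unfolding bform_def by (intro cint)
  \<comment> \<open>Vectors are functions on the whole index type, so coordinates off
    \<open>S\<close> are pinned to 0 and compactness is Tychonoff's theorem. The bound on
    \<open>S\<close> follows from \<open>2 * |x i| <= 1 + (x i)^2\<close> and
    \<open>d i * (x i)^2 <= 1\<close>.\<close>
  define box where "box = PiE UNIV (\<lambda>i. {- (if i \<in> S then 1 + 1 / d i else 0)..(if i \<in> S then 1 + 1 / d i else 0)})"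
  have q_nonneg: "q x \<ge> 0" for x unfolding q_def using dpos by (intro sum_nonneg) (simp add: less_imp_le)
  have Ksub: "K \<subseteq> box"
  proof
    fix x assume x: "x \<in> K"
    have "\<bar>x i\<bar> \<le> 1 + 1 / d i" if i: "i \<in> S" for i
    proof -
      have "d i * (x i)\<^sup>2 \<le> q x"
        unfolding q_def using dpos fin i by (intro member_le_sum) (auto simp: less_imp_le)
      then have "(x i)\<^sup>2 \<le> 1 / d i" using x dpos[OF i] by (simp add: K_def field_simps)
      moreover have "2 * \<bar>x i\<bar> \<le> 1 + (x i)\<^sup>2"
        using sum_squares_bound[of "\<bar>x i\<bar>" 1] by simp
      ultimately show ?thesis using dpos[OF i] by (smt (verit) zero_less_divide_1_iff)
    qed
    then show "x \<in> box" using x by (fastforce simp: box_def K_def Z_def abs_le_iff)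
  qed
  have "K = box \<inter> {x. (\<Sum>i\<in>S. r i * x i) = 0} \<inter> {x. q x = 1}"
    using Ksub by (auto simp: K_def Z_def box_def PiE_iff split: if_splits)
  moreover have "closed {x :: 'a \<Rightarrow> real. (\<Sum>i\<in>S. r i * x i) = 0}"
    by (intro closed_Collect_eq cint)
  moreover have "closed {x. q x = 1}"
    unfolding q_def by (intro closed_Collect_eq cint)
  moreover have "compact box" unfolding box_def by (rule compact_box_fun)
  ultimately have "compact K" by (simp add: compact_Int_closed)

  have scale: "\<exists>t y. t > 0 \<and> y \<in> K \<and> bform S M y y * t = bform S M x x \<and> t = q x"
    if x: "x \<in> Z" and qx: "q x \<noteq> 0" for x
  proof -
    have "q x > 0" using q_nonneg[of x] qx by simp
    define c where "c = 1 / sqrt (q x)"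
    have c2: "c\<^sup>2 = 1 / q x" using \<open>q x > 0\<close> by (simp add: c_def power_divide)
    have "q (\<lambda>i. c * x i) = c\<^sup>2 * q x"
      by (simp add: q_def sum_distrib_left power_mult_distrib mult_ac)
    moreover have "(\<Sum>i\<in>S. r i * (c * x i)) = c * (\<Sum>i\<in>S. r i * x i)"
      by (simp add: sum_distrib_left mult_ac)
    ultimately have "(\<lambda>i. c * x i) \<in> K" using x c2 qx by (simp add: K_def Z_def)
    moreover have "bform S M (\<lambda>i. c * x i) (\<lambda>i. c * x i) * q x = bform S M x x"
      using qx by (simp add: bform_scale c2)
    ultimately show ?thesis using \<open>q x > 0\<close> by metis
  qed
  have q_zero: "x i = 0" if "q x = 0" "i \<in> S" for x i
  proof -
    have "\<forall>i\<in>S. d i * (x i)\<^sup>2 = 0"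
      using that(1) fin dpos unfolding q_def by (subst (asm) sum_nonneg_eq_0_iff) (auto simp: less_imp_le)
    then show ?thesis using that(2) dpos by fastforce
  qed
  have bform_cong0: "bform S M x x = 0" if "q x = 0" for x
    unfolding bform_def using q_zero[OF that] by (intro sum.neutral) auto
  define w' where "w' i = (if i \<in> S then w i else 0)" for i
  have w'B: "bform S M w' w' = bform S M w w"
    unfolding bform_def w'_def by (intro sum.cong arg_cong2[where f="(*)"]) auto
  have w'Z: "w' \<in> Z" using orth unfolding row by (simp add: Z_def w'_def)
  have "q w' \<noteq> 0" using bform_cong0[of w'] w'B wpos by auto
  from scale[OF w'Z this] obtain v where v: "v \<in> K" "bform S M v v > 0"
    using w'B wpos by (metis zero_less_mult_pos2)
  obtain x where x: "x \<in> K" and xmax: "\<And>y. y \<in> K \<Longrightarrow> bform S M y y \<le> bform S M x x"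
    using continuous_attains_sup[OF \<open>compact K\<close> _ contB] v by blast
  define \<mu> where "\<mu> = bform S M x x"
  have mupos: "\<mu> > 0" using xmax[OF v(1)] v(2) by (simp add: \<mu>_def)
  have xZ: "x \<in> Z" and qx: "q x = 1" using x by (auto simp: K_def)
  have bound: "bform S M y y \<le> \<mu> * q y" if "y \<in> Z" for y
  proof (cases "q y = 0")
    case False
    from scale[OF that this] obtain z where "z \<in> K" "bform S M z z * q y = bform S M y y" by blast
    then show ?thesis using xmax[of z] q_nonneg[of y] unfolding \<mu>_def
      by (metis mult_right_mono)
  qed (simp add: bform_cong0)

  \<comment> \<open>By the first-order condition at the maximiser, \<open>x\<close> is an eigenvector with eigenvalue \<open>\<mu>\<close>
    of \<open>M\<close> relative to the weights \<open>d\<close>: \<open>y\<close> is the residual.\<close>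
  define Mx where "Mx i = (\<Sum>j\<in>S. M i j * x j)" for i
  define y where "y i = (if i \<in> S then Mx i / d i - \<mu> * x i else 0)" for i
  have yd: "d i * y i = Mx i - \<mu> * d i * x i" if "i \<in> S" for i
    using dpos[OF that] that by (simp add: y_def right_diff_distrib)
  \<comment> \<open>The residual is an admissible variation only if it stays in \<open>Z\<close>;
    both terms vanish because \<open>x\<close> is orthogonal to \<open>p\<close>.\<close>
  have "(\<Sum>i\<in>S. r i * y i) = (\<Sum>i\<in>S. p i * Mx i) - \<mu> * (\<Sum>i\<in>S. r i * x i)"
    unfolding sum_distrib_left sum_subtractf[symmetric]
  proof (intro sum.cong refl)
    fix i assume i: "i \<in> S"
    have "r i * y i = p i * (d i * y i)" using p[OF i] by (simp add: d_def)
    also have "\<dots> = p i * Mx i - \<mu> * (r i * x i)"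
      unfolding yd[OF i] using p[OF i] by (simp add: d_def algebra_simps)
    finally show "r i * y i = p i * Mx i - \<mu> * (r i * x i)" .
  qed
  also have "(\<Sum>i\<in>S. p i * Mx i) = bform S M p x" by (simp add: bform_def Mx_def)
  also have "\<dots> = (\<Sum>i\<in>S. r i * x i)" by (simp add: bform_sym[of M, OF sym, of S p x] row)
  finally have yZ: "y \<in> Z" using xZ by (simp add: Z_def y_def)
  define xy where "xy = (\<Sum>i\<in>S. d i * x i * y i)"
  have "2 * t * (bform S M x y - \<mu> * xy) + t\<^sup>2 * (bform S M y y - \<mu> * q y) \<le> 0" for t
  proof -
    have "(\<Sum>i\<in>S. r i * (x i + t * y i)) = (\<Sum>i\<in>S. r i * x i) + t * (\<Sum>i\<in>S. r i * y i)"
      by (simp add: sum.distrib sum_distrib_left algebra_simps)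
    then have "(\<lambda>i. x i + t * y i) \<in> Z" using xZ yZ by (simp add: Z_def)
    from bound[OF this] have "bform S M x x + 2 * t * bform S M x y + t\<^sup>2 * bform S M y y
        \<le> \<mu> * q (\<lambda>i. x i + t * y i)"
      by (simp add: bform_add_square[of M, OF sym])
    also have "q (\<lambda>i. x i + t * y i) = q x + 2 * t * xy + t\<^sup>2 * q y"
      by (simp add: q_def xy_def power2_eq_square sum.distrib sum_distrib_left algebra_simps)
    finally show ?thesis using qx by (simp add: \<mu>_def algebra_simps)
  qed
  then have "bform S M x y - \<mu> * xy = 0" by (rule linear_le_quadratic_imp_zero)
  \<comment> \<open>Half the derivative in the direction of the residual is the squared length of
    the residual itself.\<close>
  moreover have "bform S M x y - \<mu> * xy = q y"
    unfolding bform_sym[of M, OF sym, of S x y] unfolding bform_def xy_def q_def sum_distrib_left sum_subtractf[symmetric]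
  proof (intro sum.cong refl)
    fix i assume i: "i \<in> S"
    have "(\<Sum>j\<in>S. y i * (M i j * x j)) - \<mu> * (d i * x i * y i) = y i * (Mx i - \<mu> * d i * x i)"
      unfolding sum_distrib_left[symmetric] Mx_def[symmetric] by (simp add: algebra_simps)
    also have "\<dots> = d i * (y i)\<^sup>2" unfolding yd[OF i, symmetric] by (simp add: power2_eq_square)
    finally show "(\<Sum>j\<in>S. y i * (M i j * x j)) - \<mu> * (d i * x i * y i) = d i * (y i)\<^sup>2" .
  qed
  ultimately have "q y = 0" by simp
  have eig: "Mx i = \<mu> * d i * x i" if "i \<in> S" for i
    using yd[OF that] q_zero[OF \<open>q y = 0\<close> that] by simp

  \<comment> \<open>At an eigenvector the right-hand side of \<open>le\<close> is
    \<open>\<mu>\<close> squared times \<open>q x\<close>, so \<open>\<mu>\<close> is at most its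
    square.\<close>
  have "\<mu> \<le> (\<Sum>i\<in>S. p i * (Mx i)\<^sup>2 / r i)" using le[of x] by (simp add: \<mu>_def Mx_def)
  also have "\<dots> = \<mu>\<^sup>2 * q x"
    unfolding q_def sum_distrib_left
  proof (intro sum.cong refl)
    fix i assume i: "i \<in> S"
    show "p i * (Mx i)\<^sup>2 / r i = \<mu>\<^sup>2 * (d i * (x i)\<^sup>2)"
      using p[OF i] rpos[OF i] by (simp add: eig[OF i] d_def power2_eq_square field_simps)
  qed
  finally have "\<mu> * 1 \<le> \<mu> * \<mu>" using qx by (simp add: power2_eq_square)
  then have mu1: "\<mu> \<ge> 1" using mupos by simp

  \<comment> \<open>Perron: an eigenvector with eigenvalue at least 1 is proportional to \<open>p\<close>, since the indices
    where \<open>x i / p i\<close> is maximal are closed under adjacency.\<close>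
  have "S \<noteq> {}" using qx by (auto simp: q_def)
  define c where "c = Max ((\<lambda>i. x i / p i) ` S)"
  have cle: "x i \<le> c * p i" if "i \<in> S" for i
  proof -
    have "x i / p i \<le> c" unfolding c_def using fin that by (intro Max_ge) auto
    then show ?thesis using p[OF that] by (simp add: field_simps)
  qed
  have "c \<in> (\<lambda>i. x i / p i) ` S" unfolding c_def using fin \<open>S \<noteq> {}\<close> by (intro Max_in) auto
  then obtain i0 where i0: "i0 \<in> S" "x i0 = c * p i0" using p by force
  have "c > 0"
  proof (rule ccontr)
    assume "\<not> c > 0"
    then have "x i \<le> 0" if "i \<in> S" for i
      using cle[OF that] p[OF that] by (meson less_imp_le mult_nonpos_nonneg not_less order_trans)
    then have "\<forall>i\<in>S. - (r i * x i) = 0"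
      using xZ fin rpos
      by (subst sum_nonneg_eq_0_iff[symmetric]) (auto simp: Z_def sum_negf mult_nonneg_nonpos less_imp_le)
    then have "\<forall>i\<in>S. x i = 0" using rpos by fastforce
    then show False using qx by (simp add: q_def)
  qed
  \<comment> \<open>As \<open>\<mu>\<close> is at least 1, \<open>Mx i\<close> is at least
    \<open>c * r i\<close>; as \<open>x\<close> is at most \<open>c * p\<close>, it is also at most
    that. So \<open>x\<close> and \<open>c * p\<close> agree wherever row \<open>i\<close> is
    positive.\<close>
  have step: "x j = c * p j" if i: "i \<in> S" "x i = c * p i" and j: "j \<in> S" "M i j > 0" for i j
  proof -
    have "c * r i \<le> \<mu> * (c * r i)" using mu1 \<open>c > 0\<close> rpos[OF i(1)] by simp
    also have "\<dots> = Mx i" using i p[OF i(1)] by (simp add: eig d_def)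
    finally have "(\<Sum>j\<in>S. M i j * (c * p j - x j)) \<le> 0"
      unfolding r[OF i(1)] Mx_def by (simp add: sum_subtractf sum_distrib_left algebra_simps)
    moreover have "(\<Sum>j\<in>S. M i j * (c * p j - x j)) \<ge> 0"
      using nonneg cle by (intro sum_nonneg mult_nonneg_nonneg) auto
    ultimately have "\<forall>j\<in>S. M i j * (c * p j - x j) = 0"
      using fin nonneg cle by (subst sum_nonneg_eq_0_iff[symmetric]) auto
    then show ?thesis using j by auto
  qed
  have "x j = c * p j" if "j \<in> S" for j
    using conn[OF i0(1) that] step i0 that by blast
  then have "(\<Sum>j\<in>S. r j * x j) > 0"
    using \<open>c > 0\<close> p rpos fin \<open>S \<noteq> {}\<close> by (intro sum_pos) auto
  then show False using xZ by (simp add: Z_def)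
qed

section \<open>Polymatroids, contractions and word sums\<close>

definition inc :: "('a \<Rightarrow> nat) \<Rightarrow> 'a \<Rightarrow> 'a \<Rightarrow> nat" where
  "inc a i = a(i := Suc (a i))"

lemma inc_apply: "inc a i j = (if j = i then Suc (a j) else a j)"
  by (simp add: inc_def)

lemma inc_commute: "inc (inc a i) j = inc (inc a j) i"
  by (auto simp: fun_eq_iff inc_apply)

lemma inc_upd_cancel: "a i > 0 \<Longrightarrow> inc (a(i := a i - 1)) i = a"
  by (auto simp: fun_eq_iff inc_apply)

lemma le_inc: "a \<le> inc a i"
  by (simp add: le_fun_def inc_apply)

lemma inc_mono: "a \<le> b \<Longrightarrow> inc a i \<le> inc b i"
  by (simp add: le_fun_def inc_apply)

lemma sum_inc: "finite E \<Longrightarrow> i \<in> E \<Longrightarrow> sum (inc a i) E = Suc (sum a E)"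
  by (simp add: inc_def sum.remove)

lemma sum_inc_notin: "i \<notin> E \<Longrightarrow> sum (inc a i) E = sum a E"
  by (auto simp: inc_def intro!: sum.cong)

lemma vector_between:
  fixes a b :: "'a \<Rightarrow> nat"
  assumes fin: "finite E" and "a \<le> b" "sum a E \<le> k" "k \<le> sum b E"
  shows "\<exists>c. a \<le> c \<and> c \<le> b \<and> sum c E = k"
  using assms(2-4)
proof (induction "k - sum a E" arbitrary: a)
  case 0
  then show ?case by (intro exI[of _ a]) auto
next
  case (Suc d)
  then have "sum a E < sum b E" by simp
  then obtain i where i: "i \<in> E" "a i < b i" by (meson sum_mono not_le)
  have "\<exists>c. inc a i \<le> c \<and> c \<le> b \<and> sum c E = k"
  proof (rule Suc.hyps(1))
    show "inc a i \<le> b" using Suc.prems(1) i(2) by (auto simp: le_fun_def inc_apply)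
  qed (use Suc.hyps(2) Suc.prems in \<open>simp_all add: sum_inc[OF fin i(1)]\<close>)
  then show ?case using le_inc[of a i] order_trans by blast
qed

text \<open>On the generating function, the sum of \<open>x^a / a!\<close> over \<open>J\<close>,
  this acts as the partial derivative in the variable \<open>l\<close>; hence contractions
  commute.\<close>

definition contract :: "('a \<Rightarrow> nat) set \<Rightarrow> 'a \<Rightarrow> ('a \<Rightarrow> nat) set" where
  "contract J l = {a. inc a l \<in> J}"

lemma contract_iff [simp]: "a \<in> contract J l \<longleftrightarrow> inc a l \<in> J"
  by (simp add: contract_def)

lemma contract_commute: "contract (contract J i) j = contract (contract J j) i"
  by (simp add: contract_def inc_commute)

definition polym :: "'a set \<Rightarrow> ('a \<Rightarrow> nat) set \<Rightarrow> bool" where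
  "polym E J \<longleftrightarrow> (\<forall>a\<in>J. \<forall>b\<le>a. b \<in> J) \<and>
     (\<forall>a\<in>J. \<forall>b\<in>J. sum a E < sum b E \<longrightarrow> (\<exists>i\<in>E. a i < b i \<and> inc a i \<in> J))"

lemma polym_hereditary: "polym E J \<Longrightarrow> a \<in> J \<Longrightarrow> b \<le> a \<Longrightarrow> b \<in> J"
  by (auto simp: polym_def)

lemma polym_exchange:
  assumes "polym E J" "a \<in> J" "b \<in> J" "sum a E < sum b E"
  obtains i where "i \<in> E" "a i < b i" "inc a i \<in> J"
  using assms unfolding polym_def by blast

lemma polym_contract:
  assumes P: "polym E J" and fin: "finite E"
  shows "polym E (contract J l)"
  unfolding polym_def
proof (intro conjI ballI allI impI)
  fix a b assume "a \<in> contract J l" "b \<le> a"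
  then show "b \<in> contract J l"
    using polym_hereditary[OF P] inc_mono[of b a l] by simp
next
  fix a b assume a: "a \<in> contract J l" and b: "b \<in> contract J l" and "sum a E < sum b E"
  then have "sum (inc a l) E < sum (inc b l) E"
    using fin by (cases "l \<in> E") (simp_all add: sum_inc sum_inc_notin)
  then obtain i where "i \<in> E" "inc a l i < inc b l i" "inc (inc a l) i \<in> J"
    using polym_exchange[OF P] a b by (metis contract_iff)
  then show "\<exists>i\<in>E. a i < b i \<and> inc a i \<in> contract J l"
    by (intro bexI[of _ i]) (auto simp: inc_commute inc_apply split: if_splits)
qed

text \<open>Repeated exchange towards \<open>b\<close> raises only coordinates lying below those of
  \<open>b\<close>, whence the bound by the maximum. That bound later controls supports.\<close>

lemma polym_extend:
  assumes P: "polym E J" and fin: "finite E" and b: "b \<in> J"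
  shows "a \<in> J \<Longrightarrow> sum a E \<le> sum b E \<Longrightarrow>
    \<exists>c\<in>J. a \<le> c \<and> sum c E = sum b E \<and> (\<forall>i. c i \<le> max (a i) (b i))"
proof (induction "sum b E - sum a E" arbitrary: a)
  case 0
  then show ?case by (intro bexI[of _ a]) auto
next
  case (Suc m)
  then have "sum a E < sum b E" by simp
  then obtain i where i: "i \<in> E" "a i < b i" "inc a i \<in> J"
    using polym_exchange[OF P Suc.prems(1) b] by blast
  have "\<exists>c\<in>J. inc a i \<le> c \<and> sum c E = sum b E \<and> (\<forall>j. c j \<le> max (inc a i j) (b j))"
    using Suc.hyps(2) i fin by (intro Suc.hyps(1)) (auto simp: sum_inc)
  then obtain c where c: "c \<in> J" "inc a i \<le> c" "sum c E = sum b E"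
    "\<forall>j. c j \<le> max (inc a i j) (b j)"
    by blast
  have "c j \<le> max (a j) (b j)" for j
    using c(4)[rule_format, of j] i(2) by (auto simp: inc_apply split: if_splits)
  then show ?case using c le_inc[of a i] by (intro bexI[of _ c]) auto
qed

section \<open>Weighted word counts and their Hessians\<close>

text \<open>The total weight of the words of length \<open>m\<close> over \<open>E\<close> whose content vector lies in \<open>J\<close>.\<close>

primrec wsum :: "'a set \<Rightarrow> ('a \<Rightarrow> real) \<Rightarrow> nat \<Rightarrow> ('a \<Rightarrow> nat) set \<Rightarrow> real" where
  "wsum E p 0 J = (if (\<lambda>_. 0) \<in> J then 1 else 0)"
| "wsum E p (Suc m) J = (\<Sum>l\<in>E. p l * wsum E p m (contract J l))"

text \<open>This is \<open>m!\<close> times the Hessian at \<open>p\<close> of the degree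
  \<open>m + 2\<close> part of the generating function of the vectors of \<open>J\<close> supported
  in \<open>E\<close>. \<open>hess_row\<close> and \<open>bform_hess_pp\<close> are Euler's
  identities for it.\<close>

definition hess :: "'a set \<Rightarrow> ('a \<Rightarrow> real) \<Rightarrow> nat \<Rightarrow> ('a \<Rightarrow> nat) set \<Rightarrow> 'a \<Rightarrow> 'a \<Rightarrow> real" where
  "hess E p m J i j = wsum E p m (contract (contract J i) j)"

lemma hess_sym: "hess E p m J i j = hess E p m J j i"
  by (simp add: hess_def contract_commute)

lemma wsum_nonneg: "(\<And>i. i \<in> E \<Longrightarrow> p i \<ge> 0) \<Longrightarrow> wsum E p m J \<ge> 0"
  by (induction m arbitrary: J) (auto intro!: sum_nonneg)

lemma wsum_empty: "wsum E p m {} = 0"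
proof (induction m)
  case (Suc m)
  have "contract {} l = {}" for l :: 'a by auto
  with Suc show ?case by simp
qed simp

text \<open>Positive weight is asked only on the support of \<open>a\<close>, because the adjoined
  free element will have weight 0.\<close>

lemma wsum_pos:
  assumes P: "polym E J" and fin: "finite E" and p: "\<And>i. i \<in> E \<Longrightarrow> p i \<ge> 0"
    and a: "a \<in> J" "sum a E = m" "\<And>i. i \<in> E \<Longrightarrow> a i > 0 \<Longrightarrow> p i > 0"
  shows "wsum E p m J > 0"
  using P a
proof (induction m arbitrary: J a)
  case 0
  then show ?case using polym_hereditary[of E J a "\<lambda>_. 0"] by (auto simp: le_fun_def)
next
  case (Suc m)
  then obtain l where l: "l \<in> E" "a l > 0"
    by (metis gr0I sum.neutral zero_neq_one Suc_neq_Zero)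
  let ?b = "a(l := a l - 1)"
  have b: "inc ?b l = a" by (rule inc_upd_cancel) (rule l)
  have "sum ?b E = m" using sum_inc[OF fin l(1), of ?b] b Suc.prems(3) by simp
  then have "wsum E p m (contract J l) > 0"
  proof (intro Suc.IH[of _ ?b] polym_contract fin)
    show "?b \<in> contract J l" unfolding contract_iff b by (rule Suc.prems)
  qed (use Suc.prems in \<open>auto split: if_splits\<close>)
  then have "p l * wsum E p m (contract J l) > 0"
    using Suc.prems l by simp
  moreover have "p l * wsum E p m (contract J l) \<le> wsum E p (Suc m) J"
    using fin l p unfolding wsum.simps
    by (intro member_le_sum[where f = "\<lambda>l. p l * wsum E p m (contract J l)"] mult_nonneg_nonneg wsum_nonneg) auto
  ultimately show ?case by simp
qed

lemma wsum_nonzero_witness: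
  assumes fin: "finite E" and "wsum E p m J \<noteq> 0"
  shows "\<exists>a\<in>J. sum a E = m"
  using assms(2)
proof (induction m arbitrary: J)
  case 0
  then show ?case by (auto intro!: bexI[of _ "\<lambda>_. 0"] split: if_splits)
next
  case (Suc m)
  then obtain l where l: "l \<in> E" "wsum E p m (contract J l) \<noteq> 0"
    unfolding wsum.simps by (metis (no_types, lifting) mult_zero_right sum.neutral)
  from Suc.IH[OF l(2)] obtain a where "inc a l \<in> J" "sum a E = m" by auto
  then show ?case using l(1) fin by (intro bexI[of _ "inc a l"]) (auto simp: sum_inc)
qed

lemma hess_row: "(\<Sum>j\<in>E. hess E p m J i j * p j) = wsum E p (Suc m) (contract J i)"
  by (simp add: hess_def mult.commute)

lemma bform_hess_pp: "bform E (hess E p m J) p p = wsum E p (Suc (Suc m)) J"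
  by (simp add: bform_def hess_row)

lemma hess_Suc: "hess E p (Suc m) J i j = (\<Sum>l\<in>E. p l * hess E p m (contract J l) i j)"
proof -
  have "contract (contract (contract J i) j) l = contract (contract (contract J l) i) j" for l
    by (metis contract_commute)
  then show ?thesis by (simp add: hess_def)
qed

lemma bform_hess_Suc:
  "bform E (hess E p (Suc m) J) x y = (\<Sum>l\<in>E. p l * bform E (hess E p m (contract J l)) x y)"
proof -
  have "bform E (hess E p (Suc m) J) x y =
      (\<Sum>i\<in>E. \<Sum>j\<in>E. \<Sum>l\<in>E. p l * (x i * hess E p m (contract J l) i j * y j))"
    by (simp add: bform_def hess_Suc sum_distrib_left sum_distrib_right mult_ac)
  also have "\<dots> = (\<Sum>i\<in>E. \<Sum>l\<in>E. \<Sum>j\<in>E. p l * (x i * hess E p m (contract J l) i j * y j))"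
    by (intro sum.cong refl sum.swap)
  also have "\<dots> = (\<Sum>l\<in>E. \<Sum>i\<in>E. \<Sum>j\<in>E. p l * (x i * hess E p m (contract J l) i j * y j))"
    by (rule sum.swap)
  finally show ?thesis by (simp add: bform_def sum_distrib_left mult_ac)
qed

text \<open>This turns hyperbolicity of the contraction at \<open>i\<close> into a bound by the
  square of row \<open>i\<close> of the next Hessian.\<close>

lemma bform_contract_row:
  "bform E (hess E p m (contract J i)) x p = (\<Sum>j\<in>E. hess E p (Suc m) J i j * x j)"
  by (simp add: bform_def hess_row) (simp add: hess_def mult.commute)

section \<open>Hyperbolicity of the Hessians\<close>

text \<open>The form is the sum over the classes of the squared class sums. An element not related
  to itself is related to no element of \<open>V\<close>, so it contributes nothing.\<close>

lemma partial_equivalence_form_nonneg: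
  fixes x :: "'a \<Rightarrow> real"
  assumes fin: "finite V" and sym: "\<And>i j. R i j \<Longrightarrow> R j i"
    and trans: "\<And>i j l. i \<in> V \<Longrightarrow> j \<in> V \<Longrightarrow> l \<in> V \<Longrightarrow> R i j \<Longrightarrow> R j l \<Longrightarrow> R i l"
  shows "(\<Sum>i\<in>V. \<Sum>j\<in>V. (if R i j then x i * x j else 0)) \<ge> 0"
proof -
  define C where "C i = {j \<in> V. R i j}" for i
  have Ceq: "C i = C j" if "i \<in> V" "j \<in> V" "R i j" for i j
    using that trans[OF that(1) that(2) _ that(3)] trans[OF that(2) that(1) _ sym[OF that(3)]]
    by (auto simp: C_def)
  \<comment> \<open>Weighting each member \<open>l\<close> of a class by the inverse of the class
    size counts every class once, without choosing representatives.\<close>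
  have one: "(\<Sum>l\<in>V. if R l i \<and> R l j then 1 / real (card (C l)) else 0) = (if R i j then 1 else 0)"
    if i: "i \<in> V" and j: "j \<in> V" for i j
  proof (cases "R i j")
    case True
    have "i \<in> C i" using trans[OF i j i True sym[OF True]] i by (simp add: C_def)
    moreover have "finite (C i)" using fin by (simp add: C_def)
    ultimately have c: "card (C i) > 0" by (auto simp: card_gt_0_iff)
    have "(\<Sum>l\<in>V. if R l i \<and> R l j then 1 / real (card (C l)) else 0)
        = (\<Sum>l\<in>V. if l \<in> C i then 1 / real (card (C i)) else 0)"
    proof (intro sum.cong refl)
      fix l assume l: "l \<in> V"
      have "R l i \<and> R l j \<longleftrightarrow> l \<in> C i"
        using i l trans[OF l i j _ True] sym[of i l] sym[of l i] by (auto simp: C_def)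
      moreover have "C l = C i" if "l \<in> C i" using that i l Ceq[of i l] by (auto simp: C_def)
      ultimately show "(if R l i \<and> R l j then 1 / real (card (C l)) else 0)
          = (if l \<in> C i then 1 / real (card (C i)) else 0)" by auto
    qed
    also have "\<dots> = (\<Sum>l\<in>C i. 1 / real (card (C i)))"
      using fin by (intro sum.mono_neutral_cong_right) (auto simp: C_def)
    also have "\<dots> = 1" using c by simp
    finally show ?thesis using True by simp
  next
    case False
    then have "\<not> (R l i \<and> R l j)" if "l \<in> V" for l
      using trans[OF i that j] sym[of l i] by auto
    then have "(\<Sum>l\<in>V. if R l i \<and> R l j then 1 / real (card (C l)) else 0) = 0"
      by (intro sum.neutral ballI) auto
    then show ?thesis using False by simp
  qed
  have "(\<Sum>i\<in>V. \<Sum>j\<in>V. (if R i j then x i * x j else 0)) =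
      (\<Sum>i\<in>V. \<Sum>j\<in>V. \<Sum>l\<in>V. x i * x j * (if R l i \<and> R l j then 1 / real (card (C l)) else 0))"
    by (intro sum.cong refl) (simp add: sum_distrib_left[symmetric] one)
  also have "\<dots> = (\<Sum>i\<in>V. \<Sum>l\<in>V. \<Sum>j\<in>V. x i * x j * (if R l i \<and> R l j then 1 / real (card (C l)) else 0))"
    by (intro sum.cong refl sum.swap)
  also have "\<dots> = (\<Sum>l\<in>V. \<Sum>i\<in>V. \<Sum>j\<in>V. x i * x j * (if R l i \<and> R l j then 1 / real (card (C l)) else 0))"
    by (rule sum.swap)
  also have "\<dots> = (\<Sum>l\<in>V. (\<Sum>i\<in>V. if R l i then x i else 0)\<^sup>2 / real (card (C l)))"
    unfolding power2_eq_square sum_product sum_divide_distrib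
    by (intro sum.cong refl) auto
  also have "\<dots> \<ge> 0" by (intro sum_nonneg) auto
  finally show ?thesis .
qed

text \<open>Exchange from \<open>e_j\<close> towards \<open>e_i + e_l\<close> can only add
  \<open>i\<close> or \<open>l\<close>. Contraposed, this is transitivity of the relation that
  \<open>e_i + e_j\<close> is not in \<open>J\<close>, the analogue of parallelism in a
  matroid.\<close>

lemma polym_pair:
  assumes P: "polym E J" and fin: "finite E" and ijl: "i \<in> E" "j \<in> E" "l \<in> E"
    and j: "inc (\<lambda>_. 0) j \<in> J" and il: "inc (inc (\<lambda>_. 0) i) l \<in> J"
  shows "inc (inc (\<lambda>_. 0) j) i \<in> J \<or> inc (inc (\<lambda>_. 0) j) l \<in> J"
proof -
  have "sum (inc (\<lambda>_. 0) j) E < sum (inc (inc (\<lambda>_. 0) i) l) E"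
    using fin ijl by (simp add: sum_inc)
  then obtain m where m: "inc (\<lambda>_. 0) j m < inc (inc (\<lambda>_. 0) i) l m" "inc (inc (\<lambda>_. 0) j) m \<in> J"
    using polym_exchange[OF P j il] by metis
  then have "m = i \<or> m = l" by (auto simp: inc_apply split: if_splits)
  with m show ?thesis by auto
qed

text \<open>On \<open>V\<close> the matrix is the all-ones matrix minus the indicator of
  \<open>R\<close>, and it is 0 elsewhere. Where the coordinates over \<open>V\<close> sum to 0 the
  all-ones part vanishes. \<open>R\<close> is only a partial equivalence, since \<open>2 e_i\<close>
  may lie in \<open>J\<close>.\<close>

lemma hyperbolic_hess_0:
  assumes P: "polym E J" and fin: "finite E"
  shows "hyperbolic_on E (hess E p 0 J)"
proof (rule hyperbolic_onI)
  let ?o = "\<lambda>_. 0 :: nat"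
  define V where "V = {i \<in> E. inc ?o i \<in> J}"
  define R where "R i j \<longleftrightarrow> inc (inc ?o i) j \<notin> J" for i j
  have fV: "finite V" "V \<subseteq> E" using fin by (auto simp: V_def)
  show "hess E p 0 J i j = hess E p 0 J j i" for i j by (rule hess_sym)
  show "(\<Sum>i\<in>V. x i + t * y i) = (\<Sum>i\<in>V. x i) + t * (\<Sum>i\<in>V. y i)" for x y :: "'a \<Rightarrow> real" and t
    by (simp add: sum.distrib sum_distrib_left)
  fix x :: "'a \<Rightarrow> real" assume x0: "(\<Sum>i\<in>V. x i) = 0"
  have entry: "hess E p 0 J i j = (if i \<in> V \<and> j \<in> V then 1 - of_bool (R i j) else 0)"
    if "i \<in> E" "j \<in> E" for i j
    using that polym_hereditary[OF P, of "inc (inc ?o j) i" "inc ?o j"]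
      polym_hereditary[OF P, of "inc (inc ?o i) j" "inc ?o i"]
      le_inc[of "inc ?o j" i] le_inc[of "inc ?o i" j] inc_commute[of ?o i j]
    by (auto simp: hess_def V_def R_def)
  have "bform E (hess E p 0 J) x x = (\<Sum>i\<in>E. \<Sum>j\<in>E. if i \<in> V \<and> j \<in> V then (1 - of_bool (R i j)) * (x i * x j) else 0)"
    unfolding bform_def sum_distrib_left by (intro sum.cong refl) (auto simp: entry)
  also have "\<dots> = (\<Sum>i\<in>V. \<Sum>j\<in>V. (1 - of_bool (R i j)) * (x i * x j))"
    using fin fV by (intro sum.mono_neutral_cong_right ballI) (auto intro!: sum.mono_neutral_cong_right)
  also have "\<dots> = (\<Sum>i\<in>V. x i) * (\<Sum>j\<in>V. x j) - (\<Sum>i\<in>V. \<Sum>j\<in>V. if R i j then x i * x j else 0)"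
    unfolding sum_product sum_subtractf[symmetric] by (intro sum.cong refl) auto
  also have "\<dots> \<le> 0"
  proof -
    have "(\<Sum>i\<in>V. \<Sum>j\<in>V. if R i j then x i * x j else 0) \<ge> 0"
    proof (rule partial_equivalence_form_nonneg[OF fV(1)])
      show "R i j \<Longrightarrow> R j i" for i j by (simp add: R_def inc_commute)
      show "R i l" if "i \<in> V" "j \<in> V" "l \<in> V" "R i j" "R j l" for i j l
        using that polym_pair[OF P fin, of i j l] by (auto simp: R_def V_def inc_commute)
    qed
    then show ?thesis by (simp add: x0)
  qed
  finally show "bform E (hess E p 0 J) x x \<le> 0" .
qed

text \<open>The vector \<open>e_i + e_j\<close> extends to the size of \<open>b\<close> and is then
  cut down to size \<open>m + 2\<close>, staying above \<open>e_i + e_j\<close>.\<close>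

lemma hess_pos:
  assumes P: "polym E J" and fin: "finite E" and p: "\<And>i. i \<in> E \<Longrightarrow> p i > 0"
    and ij: "i \<in> E" "j \<in> E" "inc (inc (\<lambda>_. 0) i) j \<in> J"
    and b: "b \<in> J" "sum b E \<ge> m + 2"
  shows "hess E p m J i j > 0"
proof -
  let ?a = "inc (inc (\<lambda>_. 0) i) j"
  have a: "sum ?a E = 2" using fin ij by (simp add: sum_inc)
  then obtain c where c: "c \<in> J" "?a \<le> c" "sum c E = sum b E"
    using polym_extend[OF P fin b(1) ij(3)] b(2) by auto
  have "\<exists>c\<in>J. ?a \<le> c \<and> sum c E = m + 2"
    using vector_between[OF fin c(2), of "m + 2"] polym_hereditary[OF P c(1)] a b(2) c(3) by auto
  then obtain c where c: "c \<in> J" "?a \<le> c" "sum c E = m + 2" by blast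
  define d where "d = (\<lambda>l. c l - ?a l)"
  have dc: "inc (inc d j) i = c"
  proof
    fix x
    have "?a x \<le> c x" using c(2) by (simp add: le_fun_def)
    then show "inc (inc d j) i x = c x"
      by (cases "x = i"; cases "x = j") (simp_all add: d_def inc_apply)
  qed
  have "sum d E = m" using c(3) fin ij unfolding dc[symmetric] by (simp add: sum_inc)
  then show ?thesis
    unfolding hess_def
    using dc c(1) p by (intro wsum_pos[where a = d] polym_contract P fin) (auto simp: less_imp_le)
qed

lemma wsum_contract_pos:
  assumes P: "polym E J" and fin: "finite E" and p: "\<And>i. i \<in> E \<Longrightarrow> p i > 0"
    and l: "l \<in> E" and "wsum E p m (contract J l) \<noteq> 0"
  shows "wsum E p (Suc m) J > 0"
proof -
  obtain a where "inc a l \<in> J" "sum a E = m"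
    using wsum_nonzero_witness[OF fin assms(5)] by auto
  then show ?thesis
    using fin l p by (intro wsum_pos[OF P fin, of p "inc a l"]) (auto simp: sum_inc less_imp_le)
qed

text \<open>Some \<open>l\<close> in the support of a witness for row \<open>i\<close> has
  \<open>e_i + e_l\<close> in \<open>J\<close>; by \<open>polym_pair\<close>, \<open>j\<close> is
  joined to \<open>i\<close> directly or through \<open>l\<close>.\<close>

lemma hess_row_connected:
  assumes P: "polym E J" and fin: "finite E" and p: "\<And>i. i \<in> E \<Longrightarrow> p i > 0"
    and i: "i \<in> E" and j: "j \<in> E"
    and ri: "wsum E p (m + 2) (contract J i) > 0" and rj: "wsum E p (m + 2) (contract J j) > 0"
  shows "hess E p (Suc m) J i j > 0 \<or>
    (\<exists>l\<in>E. hess E p (Suc m) J i l > 0 \<and> hess E p (Suc m) J l j > 0)"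
proof -
  let ?o = "\<lambda>_. 0 :: nat"
  obtain a where a: "inc a i \<in> J" "sum a E = m + 2"
    using wsum_nonzero_witness[OF fin, of p "m + 2" "contract J i"] ri by auto
  obtain b where b: "inc b j \<in> J"
    using wsum_nonzero_witness[OF fin, of p "m + 2" "contract J j"] rj by auto
  have pos: "hess E p (Suc m) J k l > 0" if "k \<in> E" "l \<in> E" "inc (inc ?o k) l \<in> J" for k l
    using that a fin i by (intro hess_pos[OF P fin p, where b = "inc a i"]) (auto simp: sum_inc)
  obtain l where l: "l \<in> E" "a l > 0"
    using a(2) by (metis gr0I sum.neutral add_is_0 zero_neq_numeral)
  have "inc (inc ?o i) l \<le> inc a i" using l(2) by (auto simp: le_fun_def inc_apply)
  then have il: "inc (inc ?o i) l \<in> J" using polym_hereditary[OF P a(1)] by blast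
  have "inc ?o j \<le> inc b j" by (simp add: le_fun_def inc_apply)
  then have "inc ?o j \<in> J" using polym_hereditary[OF P b] by blast
  from polym_pair[OF P fin i j l(1) this il] show ?thesis
    using pos[OF i j] pos[OF i l(1) il] pos[OF l(1) j] l(1) inc_commute[of ?o] by metis
qed

text \<open>In the induction step the matrix is the weighted sum of the Hessians of the
  contractions. Hyperbolicity of each, tested against \<open>p\<close>, bounds its value at
  \<open>x\<close> by the squared row entry over \<open>r i\<close>; this is the hypothesis
  \<open>le\<close> of \<open>perron_form_nonpos\<close>.\<close>

lemma hyperbolic_hess_positive:
  assumes P: "polym E J" and fin: "finite E" and p: "\<And>i. i \<in> E \<Longrightarrow> p i > 0"
  shows "hyperbolic_on E (hess E p m J)"
  using P
proof (induction m arbitrary: J)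
  case 0
  then show ?case by (rule hyperbolic_hess_0[OF _ fin])
next
  case (Suc m)
  note P = Suc.prems
  have p0: "\<And>i. i \<in> E \<Longrightarrow> p i \<ge> 0" using p by (simp add: less_imp_le)
  define M where "M = hess E p (Suc m) J"
  define r where "r i = wsum E p (m + 2) (contract J i)" for i
  \<comment> \<open>Rows and columns outside \<open>S\<close> vanish, so the form lives on
    \<open>S\<close>, where Perron's argument has positive row sums.\<close>
  define S where "S = {i \<in> E. r i > 0}"
  have S: "finite S" "S \<subseteq> E" using fin by (auto simp: S_def)
  have Msym: "M i j = M j i" for i j unfolding M_def by (rule hess_sym)
  have Mnonneg: "M i j \<ge> 0" for i j unfolding M_def hess_def by (intro wsum_nonneg p0)
  have Mzero: "i \<in> S" if "M i j \<noteq> 0" "i \<in> E" "j \<in> E" for i j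
    using wsum_contract_pos[where p = p and m = "Suc m", OF polym_contract[OF P fin, of i] fin p that(3)] that
    by (simp add: M_def hess_def S_def r_def)
  have row0: "M i j = 0" if "i \<in> E" "i \<notin> S" "j \<in> E" for i j using Mzero[of i j] that by blast
  have toS: "(\<Sum>j\<in>E. M i j * x j) = (\<Sum>j\<in>S. M i j * x j)" if "i \<in> E" for i x
    using S fin Mzero[of _ i] that Msym[of i] by (intro sum.mono_neutral_right) auto
  have ES: "bform E M x y = bform S M x y" for x y
  proof -
    have "bform E M x y = (\<Sum>i\<in>S. x i * (\<Sum>j\<in>E. M i j * y j))"
      unfolding bform_def using S fin row0 by (intro sum.mono_neutral_right) (auto intro!: sum.neutral)
    also have "\<dots> = bform S M x y"
      unfolding bform_def using S toS by (intro sum.cong refl) auto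
    finally show ?thesis .
  qed
  have rM: "r i = (\<Sum>j\<in>E. M i j * p j)" for i by (simp add: r_def M_def hess_row)
  show ?case
    unfolding M_def[symmetric]
  proof (rule hyperbolic_onI[where f = "\<lambda>x. bform E M x p"])
    fix x assume "bform E M x p = 0"
    then have orth: "bform S M x p = 0" by (simp add: ES)
    have "bform S M x x \<le> 0"
    proof (rule perron_form_nonpos[OF S(1) Msym Mnonneg _ _ _ _ _ orth])
      show "p i > 0" "r i = (\<Sum>j\<in>S. M i j * p j)" "r i > 0" if "i \<in> S" for i
        using that S p toS[of i p] by (auto simp: rM S_def)
      show "M i j > 0 \<or> (\<exists>l\<in>S. M i l > 0 \<and> M l j > 0)" if "i \<in> S" "j \<in> S" for i j
      proof -
        from that have "M i j > 0 \<or> (\<exists>l\<in>E. M i l > 0 \<and> M l j > 0)"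
          unfolding M_def by (intro hess_row_connected[OF P fin p]) (auto simp: S_def r_def)
        then show ?thesis using Mzero[of _ j] that S(2) by fastforce
      qed
      fix x
      have "bform S M x x = bform E M x x" by (simp add: ES)
      also have "\<dots> = (\<Sum>l\<in>E. p l * bform E (hess E p m (contract J l)) x x)"
        unfolding M_def by (rule bform_hess_Suc)
      also have "\<dots> = (\<Sum>l\<in>S. p l * bform E (hess E p m (contract J l)) x x)"
      proof (rule sum.mono_neutral_right[OF fin S(2)], intro ballI)
        fix l assume l: "l \<in> E - S"
        have Pl: "polym E (contract J l)" by (rule polym_contract[OF P fin])
        \<comment> \<open>A nonzero entry would propagate to a positive \<open>r l\<close>, which
          puts \<open>l\<close> into \<open>S\<close>.\<close>
        have "hess E p m (contract J l) i j = 0" if "i \<in> E" "j \<in> E" for i j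
        proof (rule ccontr)
          assume "hess E p m (contract J l) i j \<noteq> 0"
          then have "wsum E p (Suc m) (contract (contract J l) i) > 0"
            using that unfolding hess_def by (intro wsum_contract_pos[OF polym_contract[OF Pl fin] fin p])
          then have "wsum E p (Suc (Suc m)) (contract J l) > 0"
            using that by (intro wsum_contract_pos[OF Pl fin p]) auto
          then show False using l by (simp add: S_def r_def)
        qed
        then show "p l * bform E (hess E p m (contract J l)) x x = 0"
          by (simp add: bform_def)
      qed
      also have "\<dots> \<le> (\<Sum>i\<in>S. p i * (\<Sum>j\<in>S. M i j * x j)\<^sup>2 / r i)"
      proof (intro sum_mono)
        fix i assume i: "i \<in> S"
        let ?H = "hess E p m (contract J i)"
        have pp: "bform E ?H p p = r i" by (simp add: bform_hess_pp r_def)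
        moreover have "bform E ?H x p = (\<Sum>j\<in>S. M i j * x j)"
          using i S(2) by (simp add: bform_contract_row M_def[symmetric] toS subset_iff)
        moreover have "hyperbolic_on E ?H" by (intro Suc.IH polym_contract[OF P fin])
        ultimately have "bform E ?H x x * r i \<le> (\<Sum>j\<in>S. M i j * x j)\<^sup>2"
          using i unfolding hyperbolic_on_def S_def by (metis (mono_tags, lifting) mem_Collect_eq)
        then have "bform E ?H x x \<le> (\<Sum>j\<in>S. M i j * x j)\<^sup>2 / r i"
          using i by (simp add: S_def field_simps)
        then show "p i * bform E ?H x x \<le> p i * (\<Sum>j\<in>S. M i j * x j)\<^sup>2 / r i"
          using p0[of i] i S(2) by (metis mult_left_mono subsetD times_divide_eq_right)
      qed
      finally show "bform S M x x \<le> (\<Sum>i\<in>S. p i * (\<Sum>j\<in>S. M i j * x j)\<^sup>2 / r i)" .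
    qed
    then show "bform E M x x \<le> 0" by (simp add: ES)
  qed (use Msym in \<open>auto simp: bform_add_left\<close>)
qed

lemma tendsto_wsum:
  "((\<lambda>e. wsum E (\<lambda>i. p i + e) m J) \<longlongrightarrow> wsum E p m J) (at_right 0)"
proof (induction m arbitrary: J)
  case (Suc m)
  have "((\<lambda>e. \<Sum>l\<in>E. (p l + e) * wsum E (\<lambda>i. p i + e) m (contract J l))
      \<longlongrightarrow> (\<Sum>l\<in>E. (p l + 0) * wsum E p m (contract J l))) (at_right 0)"
    by (intro tendsto_intros Suc.IH)
  then show ?case by simp
qed simp

text \<open>Adding a small \<open>e\<close> makes all weights positive; the strict inequality at
  \<open>y\<close> persists for small \<open>e\<close>, and the conclusion is closed under
  limits.\<close>

lemma hyperbolic_hess: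
  assumes P: "polym E J" and fin: "finite E" and p: "\<And>i. i \<in> E \<Longrightarrow> p i \<ge> 0"
  shows "hyperbolic_on E (hess E p m J)"
  unfolding hyperbolic_on_def
proof (intro allI impI)
  fix x y assume pos: "bform E (hess E p m J) y y > 0"
  define Q where "Q e = bform E (hess E (\<lambda>i. p i + e) m J)" for e
  have lim: "((\<lambda>e. Q e u v) \<longlongrightarrow> bform E (hess E p m J) u v) (at_right 0)" for u v
    unfolding Q_def bform_def hess_def by (intro tendsto_intros tendsto_wsum)
  have "\<forall>\<^sub>F e in at_right 0. Q e y y > 0"
    using order_tendstoD(1)[OF lim pos] .
  moreover have "\<forall>\<^sub>F e in at_right 0. (e::real) > 0"
    by (simp add: eventually_at_right_less)
  ultimately have "\<forall>\<^sub>F e in at_right 0. Q e x x * Q e y y \<le> (Q e x y)\<^sup>2"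
  proof eventually_elim
    case (elim e)
    have "hyperbolic_on E (hess E (\<lambda>i. p i + e) m J)"
      using p elim by (intro hyperbolic_hess_positive P fin) (simp add: add_nonneg_pos)
    then show ?case using elim unfolding hyperbolic_on_def Q_def by blast
  qed
  then show "bform E (hess E p m J) x x * bform E (hess E p m J) y y \<le> (bform E (hess E p m J) x y)\<^sup>2"
    by (intro tendsto_le[OF _ tendsto_power[OF lim] tendsto_mult[OF lim lim]]) simp_all
qed

section \<open>Descent of kernel vectors to contractions\<close>

lemma bform_rows_zero:
  assumes "\<And>i. i \<in> E \<Longrightarrow> (\<Sum>j\<in>E. M i j * y j) = 0"
  shows "bform E M x y = 0"
  using assms by (simp add: bform_def)

text \<open>
  Since \<open>H z = 0\<close>, the nonpositive numbers \<open>H\<^sub>l(z,z)\<close> of the contractions have weighted sum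
  \<open>H(z,z) = 0\<close>, so all vanish, and \<open>z\<close> is a null vector orthogonal to \<open>p\<close> for each \<open>H\<^sub>l\<close>.
\<close>

lemma hess_kernel_descends:
  assumes P: "polym E J" and fin: "finite E" and p: "\<And>i. i \<in> E \<Longrightarrow> p i \<ge> 0"
    and b: "b \<in> J" "sum b E = m + 2" "\<And>i. i \<in> E \<Longrightarrow> b i > 0 \<Longrightarrow> p i > 0"
    and a: "a \<in> J" "sum a E = m" "\<And>i. i \<in> E \<Longrightarrow> a i > 0 \<Longrightarrow> p i > 0" "\<And>i. i \<notin> E \<Longrightarrow> a i = 0"
    and ker: "\<And>i. i \<in> E \<Longrightarrow> (\<Sum>j\<in>E. hess E p m J i j * z j) = 0"
    and i: "i \<in> E"
  shows "(\<Sum>j\<in>E. if inc (inc a i) j \<in> J then z j else 0) = 0"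
  using P b a ker
proof (induction m arbitrary: J a b)
  case 0
  then have "a = (\<lambda>_. 0)" using fin by (auto simp: fun_eq_iff)
  then show ?case using "0.prems"(9)[OF i] inc_commute[of "\<lambda>_. 0" i]
    by (simp add: hess_def if_distrib[of "\<lambda>x. x * _"] cong: if_cong)
next
  case (Suc m)
  note P = Suc.prems(1) and b = Suc.prems(2-4) and a = Suc.prems(5-8) and ker = Suc.prems(9)
  let ?H = "\<lambda>l. hess E p m (contract J l)"
  have orth: "bform E (?H l) z p = 0" if "l \<in> E" for l
    using ker[OF that] by (simp add: bform_contract_row)
  \<comment> \<open>Extending \<open>d + e_l\<close> towards \<open>b\<close> uses only
    \<open>l\<close> and elements of the supports of \<open>d\<close> and \<open>b\<close>, all of
    positive weight.\<close>
  have ext: "\<exists>c\<in>contract J l. sum c E = m + 2 \<and> (\<forall>i\<in>E. c i > 0 \<longrightarrow> p i > 0)"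
    if l: "l \<in> E" "p l > 0" and d: "inc d l \<in> J" "sum d E \<le> m" "\<And>i. i \<in> E \<Longrightarrow> d i > 0 \<Longrightarrow> p i > 0" for l d
  proof -
    have "sum (inc d l) E \<le> sum b E" using d(2) b(2) l fin by (simp add: sum_inc)
    then obtain c where c: "c \<in> J" "inc d l \<le> c" "sum c E = m + 3" "\<And>i. c i \<le> max (inc d l i) (b i)"
      using polym_extend[OF P fin b(1) d(1)] b(2) by auto
    let ?c = "c(l := c l - 1)"
    have "c l > 0" using c(2) by (auto simp: le_fun_def inc_apply dest: spec[of _ l])
    then have cc: "inc ?c l = c" by (rule inc_upd_cancel)
    have "Suc (sum ?c E) = sum c E" using sum_inc[OF fin l(1), of ?c] cc by simp
    moreover have "p i > 0" if "i \<in> E" "?c i > 0" for i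
      using c(4)[of i] that l(2) b(3)[of i] d(3)[of i] by (auto simp: inc_apply le_max_iff_disj split: if_splits)
    ultimately show ?thesis using c(1,3) cc by (intro bexI[of _ ?c]) auto
  qed
  have pos: "bform E (?H l) p p > 0"
    if l: "l \<in> E" "p l > 0" and d: "inc d l \<in> J" "sum d E \<le> m" "\<And>i. i \<in> E \<Longrightarrow> d i > 0 \<Longrightarrow> p i > 0" for l d
  proof -
    note c_ex = ext[OF that]
    obtain c where c: "c \<in> contract J l" "sum c E = m + 2" "\<And>i. i \<in> E \<Longrightarrow> c i > 0 \<Longrightarrow> p i > 0"
      using c_ex by blast
    then show ?thesis
      unfolding bform_hess_pp by (intro wsum_pos[OF polym_contract[OF P fin] fin p c(1)]) simp_all
  qed
  have hyp: "hyperbolic_on E (?H l)" for l by (intro hyperbolic_hess polym_contract P fin p)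
  have le: "p l * bform E (?H l) z z \<le> 0" if l: "l \<in> E" for l
  proof (cases "p l > 0 \<and> contract J l \<noteq> {}")
    case True
    then obtain d where "inc d l \<in> J" by auto
    then have "inc (\<lambda>_. 0) l \<in> J"
      by (rule polym_hereditary[OF P]) (simp add: le_fun_def inc_apply)
    then have "bform E (?H l) p p > 0" using pos[OF l, of "\<lambda>_. 0"] True by simp
    then have "bform E (?H l) z z * bform E (?H l) p p \<le> 0"
      using hyp[of l] orth[OF l] unfolding hyperbolic_on_def by (metis zero_power2)
    then have "bform E (?H l) z z \<le> 0" using \<open>bform E (?H l) p p > 0\<close> by (simp add: mult_le_0_iff)
    then show ?thesis using p[OF l] by (simp add: mult_nonneg_nonpos)
  next
    case False
    have "contract {} j = {}" for j :: 'a by auto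
    then have "p l = 0 \<or> bform E (?H l) z z = 0"
      using False p[OF l] by (auto simp: bform_def hess_def wsum_empty)
    then show ?thesis by auto
  qed
  have "(\<Sum>l\<in>E. p l * bform E (?H l) z z) = 0"
    unfolding bform_hess_Suc[symmetric] by (rule bform_rows_zero) (rule ker)
  then have "(\<Sum>l\<in>E. - (p l * bform E (?H l) z z)) = 0" by (simp add: sum_negf)
  then have zero: "p l * bform E (?H l) z z = 0" if "l \<in> E" for l
    using that le fin by (subst (asm) sum_nonneg_eq_0_iff) auto
  \<comment> \<open>The descent goes along an element of the support of \<open>a\<close>: its weight
    is positive, and \<open>a - e_l\<close> has size \<open>m\<close> in the contraction.\<close>
  obtain l where l: "l \<in> E" "a l > 0"
    using a(2) by (metis gr0I sum.neutral Suc_neq_Zero)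
  let ?d = "a(l := a l - 1)"
  have d: "inc ?d l = a" by (rule inc_upd_cancel) (rule l)
  have ds: "sum ?d E = m" using sum_inc[OF fin l(1), of ?d] d a(2) by simp
  have pl: "p l > 0" using a(3) l by blast
  have dp: "p i > 0" if "i \<in> E" "?d i > 0" for i using a(3)[of i] that pl by (auto split: if_splits)
  have dJ: "inc ?d l \<in> J" unfolding d by (rule a(1))
  have "bform E (?H l) z z = 0" using zero[OF l(1)] pl by simp
  then have null: "bform E (?H l) z y = 0" for y
    using hyperbolic_on_null[OF hess_sym hyp pos[OF l(1) pl dJ _ dp] orth[OF l(1)]] ds by simp
  from ext[OF l(1) pl dJ _ dp] ds obtain c where
    c: "c \<in> contract J l" "sum c E = m + 2" "\<forall>i\<in>E. c i > 0 \<longrightarrow> p i > 0" by auto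
  have "(\<Sum>j\<in>E. if inc (inc ?d i) j \<in> contract J l then z j else 0) = 0"
  proof (rule Suc.IH[OF polym_contract[OF P fin] c(1,2)])
    show "(\<Sum>j\<in>E. ?H l i j * z j) = 0" if "i \<in> E" for i
    proof -
      \<comment> \<open>Testing against an indicator vector recovers the single row.\<close>
      have "(\<Sum>j\<in>E. ?H l i j * z j) = bform E (?H l) (\<lambda>k. of_bool (k = i)) z"
        using that fin by (simp add: bform_def of_bool_def if_distrib[of "\<lambda>x. x * _"] cong: if_cong)
      also have "\<dots> = 0" using null by (subst bform_sym[of "?H l", OF hess_sym])
      finally show ?thesis .
    qed
    show "?d \<in> contract J l" unfolding contract_iff by (rule dJ)
    show "?d i = 0" if "i \<notin> E" for i using a(4)[OF that] l(1) that by auto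
  qed (use c ds dp in auto)
  moreover have "inc (inc (inc ?d i) j) l = inc (inc a i) j" for j
    using d by (metis inc_commute)
  ultimately show ?case by simp
qed

section \<open>The equality case\<close>

text \<open>The coordinate \<open>z\<close> is unbounded, so contracting at \<open>z\<close> returns
  the same family. With weight 0 at \<open>z\<close>, only words avoiding \<open>z\<close>
  count.\<close>

definition free_extension :: "'a \<Rightarrow> ('a \<Rightarrow> nat) set \<Rightarrow> ('a \<Rightarrow> nat) set" where
  "free_extension z J = {a. a(z := 0) \<in> J}"

lemma free_extension_iff [simp]: "a \<in> free_extension z J \<longleftrightarrow> a(z := 0) \<in> J"
  by (simp add: free_extension_def)

lemma inc_zero_same: "(inc a z)(z := 0) = a(z := 0)"
  by (simp add: inc_def)

lemma inc_zero_other: "i \<noteq> z \<Longrightarrow> (inc a i)(z := 0) = inc (a(z := 0)) i"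
  by (auto simp: inc_def)

lemma contract_free_extension_same: "contract (free_extension z J) z = free_extension z J"
  by (auto simp: inc_zero_same)

lemma contract_free_extension_other: "l \<noteq> z \<Longrightarrow> contract (free_extension z J) l = free_extension z (contract J l)"
  by (auto simp: inc_zero_other)

lemma polym_free_extension:
  assumes P: "polym E J" and fin: "finite E" and z: "z \<notin> E"
  shows "polym (insert z E) (free_extension z J)"
  unfolding polym_def
proof (intro conjI ballI allI impI)
  fix a b assume a: "a \<in> free_extension z J" and "b \<le> a"
  then have "b(z := 0) \<le> a(z := 0)" by (auto simp: le_fun_def)
  with a show "b \<in> free_extension z J" using polym_hereditary[OF P] by auto
next
  fix a b assume a: "a \<in> free_extension z J" and b: "b \<in> free_extension z J"
    and less: "sum a (insert z E) < sum b (insert z E)"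
  show "\<exists>i\<in>insert z E. a i < b i \<and> inc a i \<in> free_extension z J"
  proof (cases "a z < b z")
    case True
    then show ?thesis using a by (intro bexI[of _ z]) (auto simp: inc_zero_same)
  next
    case False
    have off: "sum (c(z := 0)) E = sum c E" for c :: "'a \<Rightarrow> nat"
      using z by (intro sum.cong) auto
    have "sum (a(z := 0)) E < sum (b(z := 0)) E"
      using False less z fin unfolding off by simp
    then obtain i where i: "i \<in> E" "(a(z := 0)) i < (b(z := 0)) i" "inc (a(z := 0)) i \<in> J"
      using polym_exchange[OF P] a b by (metis free_extension_iff)
    then have "i \<noteq> z" using z by auto
    then show ?thesis using i by (intro bexI[of _ i]) (auto simp: inc_zero_other)
  qed
qed

lemma wsum_free_extension:
  assumes fin: "finite E" and z: "z \<notin> E"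
  shows "wsum (insert z E) (p(z := 0)) m (free_extension z J) = wsum E p m J"
proof (induction m arbitrary: J)
  case (Suc m)
  have "(\<Sum>l\<in>E. (p(z := 0)) l * wsum (insert z E) (p(z := 0)) m (contract (free_extension z J) l))
      = (\<Sum>l\<in>E. p l * wsum E p m (contract J l))"
  proof (intro sum.cong refl)
    fix l assume "l \<in> E"
    then have "l \<noteq> z" using z by auto
    then show "(p(z := 0)) l * wsum (insert z E) (p(z := 0)) m (contract (free_extension z J) l)
        = p l * wsum E p m (contract J l)"
      by (simp add: contract_free_extension_other Suc.IH)
  qed
  then show ?case using fin z by (simp del: fun_upd_apply add: fun_upd_same)
qed (simp add: fun_upd_idem)

text \<open>In the kernel vector the free element has coordinate 1 and every other \<open>j\<close>
  has \<open>- c * p j\<close>. The free element can always be added, so row \<open>z\<close> of the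
  kernel equation at \<open>a\<close> gives the first identity and row \<open>i\<close> the
  second.\<close>

lemma equality_local:
  assumes P: "polym E J" and fin: "finite E" and z: "z \<notin> E" and p: "\<And>i. i \<in> E \<Longrightarrow> p i > 0"
    and eq: "(wsum E p (Suc m) J)\<^sup>2 = wsum E p m J * wsum E p (Suc (Suc m)) J"
    and pos: "wsum E p (Suc (Suc m)) J > 0"
  obtains c where
    "\<And>a. a \<in> J \<Longrightarrow> sum a E = m \<Longrightarrow> (\<And>i. i \<notin> E \<Longrightarrow> a i = 0) \<Longrightarrow>
      c * (\<Sum>j\<in>E. if inc a j \<in> J then p j else 0) = 1"
    "\<And>a i. a \<in> J \<Longrightarrow> sum a E = m \<Longrightarrow> (\<And>i. i \<notin> E \<Longrightarrow> a i = 0) \<Longrightarrow> i \<in> E \<Longrightarrow> inc a i \<in> J \<Longrightarrow>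
      c * (\<Sum>j\<in>E. if inc (inc a i) j \<in> J then p j else 0) = 1"
proof -
  let ?F = "insert z E" and ?q = "p(z := 0)" and ?K = "free_extension z J"
  let ?M = "hess ?F ?q m ?K"
  have finF: "finite ?F" using fin by simp
  have PK: "polym ?F ?K" by (rule polym_free_extension[OF P fin z])
  have q: "?q i \<ge> 0" if "i \<in> ?F" for i using that p[of i] by auto
  define e :: "'a \<Rightarrow> real" where "e i = of_bool (i = z)" for i
  have row: "bform ?F ?M e y = (\<Sum>j\<in>?F. ?M z j * y j)" for y
    using finF z fin unfolding bform_def e_def by (simp add: of_bool_def sum.neutral)
  have ee: "bform ?F ?M e e = wsum E p m J"
  proof -
    have "bform ?F ?M e e = ?M z z"
      unfolding row using fin z by (simp add: e_def of_bool_def sum.neutral)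
    then show ?thesis by (simp add: hess_def contract_free_extension_same wsum_free_extension[OF fin z])
  qed
  have eq': "bform ?F ?M e ?q = wsum E p (Suc m) J"
    unfolding row hess_row contract_free_extension_same by (rule wsum_free_extension[OF fin z])
  have qq: "bform ?F ?M ?q ?q = wsum E p (Suc (Suc m)) J"
    unfolding bform_hess_pp by (rule wsum_free_extension[OF fin z])
  \<comment> \<open>This \<open>c\<close> makes \<open>v\<close> orthogonal to \<open>?q\<close>;
    the assumed equality then makes \<open>v\<close> a null vector.\<close>
  define c where "c = wsum E p (Suc m) J / wsum E p (Suc (Suc m)) J"
  define v where "v i = e i + (- c) * ?q i" for i
  have orth: "bform ?F ?M v ?q = 0"
    unfolding v_def bform_add_left eq' qq using pos by (simp add: c_def)
  have "bform ?F ?M v v = wsum E p m J - 2 * c * wsum E p (Suc m) J + c\<^sup>2 * wsum E p (Suc (Suc m)) J"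
    unfolding v_def bform_add_square[of ?M, OF hess_sym] ee eq' qq by simp
  also have "\<dots> = wsum E p m J - (wsum E p (Suc m) J)\<^sup>2 / wsum E p (Suc (Suc m)) J"
    unfolding c_def using pos by (simp add: power2_eq_square)
  also have "\<dots> = 0" unfolding eq using pos by simp
  finally have null: "bform ?F ?M v v = 0" .
  have zero: "bform ?F ?M v y = 0" for y
    using hyperbolic_on_null[OF hess_sym hyperbolic_hess[OF PK finF q] _ orth null] pos
    unfolding qq by blast
  have ker: "(\<Sum>j\<in>?F. ?M i j * v j) = 0" if "i \<in> ?F" for i
  proof -
    have "(\<Sum>j\<in>?F. ?M i j * v j) = bform ?F ?M (\<lambda>k. of_bool (k = i)) v"
      using that finF by (simp only: bform_def of_bool_def if_distrib[of "\<lambda>x. x * _"] sum.delta' sum.delta mult_1 mult_zero_left if_True cong: if_cong)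
    also have "\<dots> = 0" using zero by (subst bform_sym[of ?M, OF hess_sym])
    finally show ?thesis .
  qed
  obtain b0 where b0: "b0 \<in> J" "sum b0 E = m + 2"
    using wsum_nonzero_witness[OF fin, of p "Suc (Suc m)" J] pos by auto
  \<comment> \<open>Clearing the entries outside \<open>E\<close>, in particular at
    \<open>z\<close>, keeps the size at \<open>m + 2\<close> on the enlarged ground set.\<close>
  define b where "b i = (if i \<in> E then b0 i else 0)" for i
  have "b \<in> J" by (rule polym_hereditary[OF P b0(1)]) (auto simp: b_def le_fun_def)
  have bz: "b(z := 0) = b" using z by (auto simp: b_def)
  have bs: "sum b ?F = m + 2" using b0(2) z fin by (simp add: b_def)
  have v: "v z = 1" "\<And>j. j \<in> E \<Longrightarrow> v j = - c * p j"
    using z by (auto simp: v_def e_def)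
  have loc: "(\<Sum>j\<in>?F. if inc (inc a i) j \<in> ?K then v j else 0) = 0"
    if a: "a \<in> J" "sum a E = m" "\<And>i. i \<notin> E \<Longrightarrow> a i = 0" and i: "i \<in> ?F" for a i
  proof (rule hess_kernel_descends[OF PK finF q _ bs _ _ _ _ _ ker i])
    have "a z = 0" using a(3) z by blast
    then show "a \<in> ?K" "sum a ?F = m" using a fin z by (auto simp: fun_upd_idem)
    show "?q i > 0" if "i \<in> ?F" "a i > 0" for i using that p[of i] \<open>a z = 0\<close> by auto
    show "?q i > 0" if "i \<in> ?F" "b i > 0" for i using that p[of i] z by (auto simp: b_def)
  qed (use \<open>b \<in> J\<close> a in \<open>auto simp: bz\<close>)
  have expand: "c * (\<Sum>j\<in>E. if Q j then p j else 0) = 1"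
    if "(\<Sum>j\<in>?F. if R j then v j else 0) = 0" "R z" "\<And>j. j \<in> E \<Longrightarrow> R j = Q j" for R Q
  proof -
    have "(\<Sum>j\<in>E. if R j then v j else 0) = (\<Sum>j\<in>E. - c * (if Q j then p j else 0))"
      using that(3) v(2) by (intro sum.cong) auto
    then show ?thesis using that(1,2) fin z v(1) by (simp add: sum_distrib_left sum_negf)
  qed
  show ?thesis
  proof (rule that[of c])
    fix a assume a: "a \<in> J" "sum a E = m" "\<And>i. i \<notin> E \<Longrightarrow> a i = 0"
    have az: "a(z := 0) = a" using a(3)[of z] z by auto
    have loc_a: "(\<Sum>j\<in>?F. if inc (inc a i) j \<in> ?K then v j else 0) = 0" if "i \<in> ?F" for i
      by (rule loc) (use a that in auto)
    show "c * (\<Sum>j\<in>E. if inc a j \<in> J then p j else 0) = 1"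
    proof (rule expand[OF loc_a[of z]])
      show "inc (inc a z) z \<in> ?K" using a(1) az by (simp add: inc_zero_same)
      fix j assume "j \<in> E"
      then have "j \<noteq> z" using z by auto
      then show "(inc (inc a z) j \<in> ?K) = (inc a j \<in> J)"
        using az by (simp add: inc_zero_other inc_zero_same)
    qed simp
    fix i assume i: "i \<in> E" "inc a i \<in> J"
    then have iz: "i \<noteq> z" using z by auto
    show "c * (\<Sum>j\<in>E. if inc (inc a i) j \<in> J then p j else 0) = 1"
    proof (rule expand[OF loc_a[of i]])
      show "inc (inc a i) z \<in> ?K" using i(2) az iz by (simp add: inc_zero_same inc_zero_other)
      fix j assume "j \<in> E"
      then have "j \<noteq> z" using z by auto
      then show "(inc (inc a i) j \<in> ?K) = (inc (inc a i) j \<in> J)"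
        using az iz by (simp add: inc_zero_other)
    qed (use i in simp)
  qed
qed

text \<open>\<open>c1\<close> and \<open>c2\<close> fix the weight of the set \<open>S a\<close> of
  elements addable to \<open>a\<close>. Nested sets of equal weight coincide, so \<open>S\<close> is
  unchanged when a unit is added at, or moved to, an element of \<open>S a\<close>. Nondegeneracy
  makes \<open>S a\<close> all of \<open>E\<close>; unit moves then reach every vector of size
  \<open>m\<close>, and two additions reach size \<open>m + 2\<close>.\<close>

lemma all_vectors_in_polym:
  fixes p :: "'a \<Rightarrow> real"
  assumes P: "polym E J" and fin: "finite E" and p: "\<And>i. i \<in> E \<Longrightarrow> p i > 0"
    and nondeg: "\<And>i. i \<in> E \<Longrightarrow> inc (\<lambda>_. 0) i \<in> J"
    and a0: "a0 \<in> J" "sum a0 E = m" "\<And>i. i \<notin> E \<Longrightarrow> a0 i = 0"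
    and c1: "\<And>a. a \<in> J \<Longrightarrow> sum a E = m \<Longrightarrow> (\<And>i. i \<notin> E \<Longrightarrow> a i = 0) \<Longrightarrow>
      c * (\<Sum>j\<in>E. if inc a j \<in> J then p j else 0) = 1"
    and c2: "\<And>a i. a \<in> J \<Longrightarrow> sum a E = m \<Longrightarrow> (\<And>i. i \<notin> E \<Longrightarrow> a i = 0) \<Longrightarrow> i \<in> E \<Longrightarrow> inc a i \<in> J \<Longrightarrow>
      c * (\<Sum>j\<in>E. if inc (inc a i) j \<in> J then p j else 0) = 1"
    and g: "sum g E \<le> m + 2" "\<And>i. i \<notin> E \<Longrightarrow> g i = 0"
  shows "g \<in> J"
proof -
  define L where "L = {a \<in> J. sum a E = m \<and> (\<forall>i. i \<notin> E \<longrightarrow> a i = 0)}"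
  define S where "S a = {j \<in> E. inc a j \<in> J}" for a
  have Ssum: "(\<Sum>j\<in>E. if inc a j \<in> J then p j else 0) = sum p (S a)" for a
    unfolding S_def using fin by (intro sum.mono_neutral_cong_right) auto
  have c1': "c * sum p (S a) = 1" if "a \<in> L" for a
    using c1[of a] that unfolding Ssum L_def by simp
  have c2': "c * sum p (S (inc a i)) = 1" if "a \<in> L" "i \<in> S a" for a i
    using c2[of a i] that unfolding Ssum L_def S_def by simp
  have Seq: "A = B" if AB: "A \<subseteq> B" "B \<subseteq> E" "c * sum p A = 1" "c * sum p B = 1" for A B
  proof (rule ccontr)
    assume "A \<noteq> B"
    then obtain x where x: "x \<in> B" "x \<notin> A" using AB(1) by blast
    have "finite B" using AB(2) fin finite_subset by blast
    then have "sum p A < sum p B"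
      using AB(1,2) x p by (intro sum_strict_mono2[of B A x]) (auto simp: less_imp_le subset_iff)
    moreover have "c * sum p A = c * sum p B" "c \<noteq> 0" using AB(3,4) by auto
    ultimately show False by simp
  qed
  have SE: "S a \<subseteq> E" for a by (auto simp: S_def)
  have Sinc: "S (inc a i) = S a" if a: "a \<in> L" and i: "i \<in> S a" for a i
  proof (rule Seq[OF _ SE c2'[OF a i] c1'[OF a]])
    show "S (inc a i) \<subseteq> S a"
      using polym_hereditary[OF P _ inc_mono[OF le_inc]] by (auto simp: S_def)
  qed
  \<comment> \<open>Here \<open>a' = a + e_i - e_l\<close> lies below \<open>a + e_i\<close>, so
    \<open>S a = S (a + e_i)\<close> is contained in \<open>S a'\<close>.\<close>
  have swap: "a' \<in> L" "S a' = S a"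
    if a: "a \<in> L" and i: "i \<in> S a" and l: "l \<in> E" and a': "inc a' l = inc a i" for a a' i l
  proof -
    have "a' \<in> J" using polym_hereditary[OF P _ le_inc[of a' l]] i unfolding a' by (auto simp: S_def)
    moreover have "Suc (sum a' E) = Suc (sum a E)"
      using sum_inc[OF fin l, of a'] sum_inc[OF fin, of i a] i unfolding a' by (simp add: S_def)
    moreover have "a' x = 0" if "x \<notin> E" for x
    proof -
      have "inc a' l x = 0" unfolding a' using that a i by (auto simp: L_def S_def inc_apply)
      then show ?thesis by (simp add: inc_apply split: if_splits)
    qed
    ultimately show a'L: "a' \<in> L" using a by (simp add: L_def)
    have "S a \<subseteq> S a'"
    proof
      fix j assume "j \<in> S a"
      then have "j \<in> E" "inc (inc a' l) j \<in> J" using Sinc[OF a i] unfolding a' by (auto simp: S_def)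
      then show "j \<in> S a'"
        using polym_hereditary[OF P _ inc_mono[OF le_inc]] by (auto simp: S_def)
    qed
    from Seq[OF this SE c1'[OF a] c1'[OF a'L]] show "S a' = S a" by simp
  qed
  have full: "j \<in> S a" if "a \<in> L" "j \<in> E" for a j
    using that
  proof (induction "a j" arbitrary: a rule: less_induct)
    case less
    have "S a \<noteq> {}" using c1'[OF less.prems(1)] by auto
    then obtain i where i: "i \<in> S a" by blast
    then have iE: "i \<in> E" "inc a i \<in> J" by (auto simp: S_def)
    show ?case
    proof (cases "i = j")
      case False
      show ?thesis
      proof (cases "a j = 0")
        case True
        \<comment> \<open>Extending \<open>e_j\<close> towards \<open>a + e_i\<close> gives
          \<open>b\<close> of the same size below their maximum. Comparing sizes yields
          \<open>b = a + e_i - e_l + e_j\<close> with \<open>l\<close> distinct from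
          \<open>j\<close>, so \<open>j\<close> is addable to \<open>d = a + e_i - e_l\<close>, and
          \<open>S d = S a\<close>.\<close>
        have "sum (inc (\<lambda>_. 0) j) E \<le> sum (inc a i) E"
          using fin iE less.prems by (simp add: sum_inc)
        from polym_extend[OF P fin iE(2) nondeg[OF less.prems(2)] this]
        obtain b where b: "b \<in> J" "inc (\<lambda>_. 0) j \<le> b" "sum b E = sum (inc a i) E"
          "\<And>x. b x \<le> max (inc (\<lambda>_. 0) j x) (inc a i x)" by blast
        have bj: "b j \<ge> 1" using b(2) by (auto simp: le_fun_def inc_apply dest: spec[of _ j])
        have "\<exists>l\<in>E. b l < inc a i l"
        proof (rule ccontr)
          assume "\<not> (\<exists>l\<in>E. b l < inc a i l)"
          then have "sum (inc a i) E < sum b E"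
            using fin less.prems(2) bj True False
            by (intro sum_strict_mono_ex1) (auto simp: inc_apply not_less intro!: bexI[of _ j])
          then show False using b(3) by simp
        qed
        then obtain l where l: "l \<in> E" "b l < inc a i l" by blast
        define d where "d = (inc a i)(l := inc a i l - 1)"
        have d: "inc d l = inc a i" unfolding d_def by (rule inc_upd_cancel) (use l in simp)
        have lj: "l \<noteq> j" using l(2) bj True False by (auto simp: inc_apply)
        have ble: "b x \<le> inc d j x" for x
          using b(4)[of x] l(2) lj True False
          by (cases "x = j"; cases "x = l") (auto simp: d_def inc_apply split: if_splits)
        have ds: "sum (inc d j) E = sum b E"
          using sum_inc[OF fin l(1), of d] sum_inc[OF fin less.prems(2), of d] b(3) unfolding d by simp
        have "inc d j \<le> b"
        proof (rule le_funI, rule ccontr)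
          fix x assume x: "\<not> inc d j x \<le> b x"
          have dL: "d \<in> L" by (rule swap(1)[OF less.prems(1) i l(1) d])
          then have "x \<in> E" using x less.prems(2) by (auto simp: L_def inc_apply split: if_splits)
          then have "sum b E < sum (inc d j) E"
            using x ble fin by (intro sum_strict_mono_ex1) (auto simp: not_le)
          then show False using ds by simp
        qed
        then have "inc d j \<in> J" using polym_hereditary[OF P b(1)] by blast
        then have "j \<in> S d" using less.prems(2) by (simp add: S_def)
        then show ?thesis using swap(2)[OF less.prems(1) i l(1) d] by simp
      next
        case aj: False
        \<comment> \<open>Moving a unit from \<open>j\<close> to \<open>i\<close> lowers the
          induction measure \<open>a j\<close> and preserves \<open>S\<close>.\<close>
        define d where "d = (inc a i)(j := inc a i j - 1)"
        have d: "inc d j = inc a i" unfolding d_def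
          by (rule inc_upd_cancel) (use aj in \<open>simp add: inc_apply\<close>)
        have "d j < a j" using aj False by (simp add: d_def inc_apply)
        then show ?thesis
          using less.hyps[OF _ swap(1)[OF less.prems(1) i less.prems(2) d]]
            swap(2)[OF less.prems(1) i less.prems(2) d] less.prems(2) by simp
      qed
    qed (use i in simp)
  qed
  then have SEq: "S a = E" if "a \<in> L" for a using that SE by blast
  have bottom: "b \<in> L" if b: "sum b E = m" "\<And>i. i \<notin> E \<Longrightarrow> b i = 0" for b
  proof -
    have "b \<in> J" if "a \<in> L" for a
      using that
    \<comment> \<open>Truncated subtraction measures how far \<open>a\<close> falls short of
      \<open>b\<close>; moving a unit from an excess coordinate to a deficient one lowers
      it.\<close>
    proof (induction "\<Sum>i\<in>E. b i - a i" arbitrary: a rule: less_induct)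
      case less
      show ?case
      proof (cases "\<forall>i\<in>E. b i \<le> a i")
        case True
        then have "b \<le> a" using b(2) by (metis le_funI zero_le)
        then show ?thesis using polym_hereditary[OF P] less.prems by (auto simp: L_def)
      next
        case False
        then obtain i where i: "i \<in> E" "a i < b i" by (auto simp: not_le)
        have "\<exists>l\<in>E. b l < a l"
        proof (rule ccontr)
          assume "\<not> (\<exists>l\<in>E. b l < a l)"
          then have "sum a E < sum b E"
            using fin i by (intro sum_strict_mono_ex1) (auto simp: not_less)
          then show False using b less.prems by (simp add: L_def)
        qed
        then obtain l where l: "l \<in> E" "b l < a l" by blast
        then have il: "i \<noteq> l" using i by auto
        define d where "d = (inc a i)(l := inc a i l - 1)"
        have d: "inc d l = inc a i" unfolding d_def
          by (rule inc_upd_cancel) (use l in \<open>simp add: inc_apply\<close>)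
        have "i \<in> S a" using SEq[OF less.prems] i by simp
        then have dL: "d \<in> L" by (rule swap(1)[OF less.prems _ l(1) d])
        have "(\<Sum>i\<in>E. b i - d i) < (\<Sum>i\<in>E. b i - a i)"
          using fin i l il by (intro sum_strict_mono_ex1) (auto simp: d_def inc_apply)
        then show ?thesis by (rule less.hyps[OF _ dL])
      qed
    qed
    moreover have "a0 \<in> L" using a0 by (simp add: L_def)
    ultimately show ?thesis using b by (auto simp: L_def)
  qed
  have dec: "\<exists>b i. i \<in> E \<and> h = inc b i \<and> sum b E = k \<and> (\<forall>i. i \<notin> E \<longrightarrow> b i = 0)"
    if h: "sum h E = Suc k" "\<And>i. i \<notin> E \<Longrightarrow> h i = 0" for h k
  proof -
    obtain i where i: "i \<in> E" "h i > 0" using h(1) by (metis gr0I sum.neutral Suc_neq_Zero)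
    let ?b = "h(i := h i - 1)"
    have b: "inc ?b i = h" by (rule inc_upd_cancel) (rule i)
    moreover have "sum ?b E = k" using sum_inc[OF fin i(1), of ?b] b h(1) by simp
    moreover have "?b x = 0" if "x \<notin> E" for x using h(2)[OF that] i that by auto
    ultimately show ?thesis using i(1) by metis
  qed
  have top: "h \<in> J" if h: "sum h E = m + 2" "\<And>i. i \<notin> E \<Longrightarrow> h i = 0" for h
  proof -
    obtain h' j where h': "j \<in> E" "h = inc h' j" "sum h' E = Suc m" "\<And>i. i \<notin> E \<Longrightarrow> h' i = 0"
      using dec[of h "Suc m"] h by auto
    obtain b i where b: "i \<in> E" "h' = inc b i" "sum b E = m" "\<And>i. i \<notin> E \<Longrightarrow> b i = 0"
      using dec[of h' m] h' by auto
    have "b \<in> L" using bottom[of b] b(3,4) by blast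
    then have "j \<in> S (inc b i)" using Sinc[of b i] SEq[of b] b(1) h'(1) by simp
    then show ?thesis by (simp add: S_def b(2) h'(2))
  qed
  have "a0 \<in> L" using a0 by (simp add: L_def)
  then have "S a0 \<noteq> {}" using c1' by force
  then obtain e where e: "e \<in> E" using SE by blast
  \<comment> \<open>Filling up one coordinate brings \<open>g\<close> to size exactly
    \<open>m + 2\<close>.\<close>
  define h where "h = g(e := g e + (m + 2 - sum g E))"
  have "sum h E = sum g E + (m + 2 - sum g E)"
    using fin e by (simp add: h_def sum.remove[of E e])
  then have "h \<in> J" using g e by (intro top) (auto simp: h_def)
  moreover have "g \<le> h" by (simp add: h_def le_fun_def)
  ultimately show ?thesis using polym_hereditary[OF P] by blast
qed

text \<open>Every word counts, which expands the power of the total weight. For the converse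
  direction this makes the word sums a geometric sequence.\<close>

lemma wsum_full:
  assumes fin: "finite E" and "\<And>a. sum a E = m \<Longrightarrow> (\<And>i. i \<notin> E \<Longrightarrow> a i = 0) \<Longrightarrow> a \<in> J"
  shows "wsum E p m J = (sum p E) ^ m"
  using assms(2)
proof (induction m arbitrary: J)
  case (Suc m)
  have "wsum E p m (contract J l) = (sum p E) ^ m" if l: "l \<in> E" for l
  proof (rule Suc.IH)
    fix a assume "sum a E = m" "\<And>i. i \<notin> E \<Longrightarrow> a i = 0"
    then show "a \<in> contract J l"
      unfolding contract_iff using l fin by (intro Suc.prems) (simp add: sum_inc, auto simp: inc_apply)
  qed
  then show ?case by (simp add: sum_distrib_right)
qed simp

section \<open>Weighted levels and polygirth\<close>

lemma finite_contract:
  assumes "finite J" shows "finite (contract J l)"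
proof -
  have "inj (\<lambda>a. inc a l)"
    by (rule injI) (auto simp: fun_eq_iff inc_apply split: if_splits)
  then show ?thesis using finite_vimageI[OF assms] by (simp add: contract_def vimage_def)
qed

lemma contract_subset_nvecs:
  assumes "J \<subseteq> nvecs n" shows "contract J l \<subseteq> nvecs n"
proof
  fix a assume "a \<in> contract J l"
  then have "\<forall>i. i \<notin> {1..n} \<longrightarrow> inc a l i = 0" using assms by (auto simp: nvecs_def)
  then show "a \<in> nvecs n" by (auto simp: nvecs_def inc_apply split: if_splits)
qed

lemma vweight_inc: "l \<in> {1..n} \<Longrightarrow> vweight n \<omega> (inc a l) = \<omega> l * vweight n \<omega> a"
proof -
  assume l: "l \<in> {1..n}"
  have "vweight n \<omega> (inc a l) = (\<Prod>i\<in>{1..n}. (if i = l then \<omega> i else 1) * \<omega> i ^ a i)"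
    unfolding vweight_def by (intro prod.cong refl) (simp add: inc_apply)
  also have "\<dots> = \<omega> l * vweight n \<omega> a"
    using l by (subst prod.distrib) (simp add: vweight_def)
  finally show ?thesis .
qed

lemma vfact_inc: "l \<in> {1..n} \<Longrightarrow> vfact n (inc a l) = real (Suc (a l)) * vfact n a"
proof -
  assume l: "l \<in> {1..n}"
  have "vfact n (inc a l) = (\<Prod>i\<in>{1..n}. (if i = l then real (Suc (a i)) else 1) * fact (a i))"
    unfolding vfact_def by (intro prod.cong refl) (simp add: inc_apply)
  also have "\<dots> = real (Suc (a l)) * vfact n a"
    using l by (subst prod.distrib) (simp add: vfact_def)
  finally show ?thesis .
qed

lemma vsize_inc: "l \<in> {1..n} \<Longrightarrow> vsize n (inc a l) = Suc (vsize n a)"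
  unfolding vsize_def by (rule sum_inc) simp_all

text \<open>Write \<open>k + 1\<close> as the sum of the \<open>c l\<close> and interchange the
  sums; for \<open>c = a + e_l\<close> the factor \<open>c l\<close> cancels against the factorial
  and leaves \<open>\<omega> l\<close> times the term of \<open>a\<close>.\<close>

lemma weighted_level_Suc:
  assumes "finite J"
  shows "real (Suc k) * weighted_level n J \<omega> (Suc k) =
    (\<Sum>l\<in>{1..n}. \<omega> l * weighted_level n (contract J l) \<omega> k)"
proof -
  let ?t = "\<lambda>a. vweight n \<omega> a / vfact n a"
  let ?L = "level n J (Suc k)"
  have fin: "finite ?L" using assms by (simp add: level_def)
  have "real (Suc k) * weighted_level n J \<omega> (Suc k) = (\<Sum>c\<in>?L. \<Sum>l\<in>{1..n}. real (c l) * ?t c)"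
    unfolding weighted_level_def sum_distrib_left sum_distrib_right[symmetric]
  proof (intro sum.cong refl)
    fix c assume "c \<in> ?L"
    then have "real (Suc k) = (\<Sum>l\<in>{1..n}. real (c l))"
      by (simp add: level_def vsize_def of_nat_sum[symmetric] del: of_nat_sum of_nat_Suc)
    then show "real (Suc k) * ?t c = (\<Sum>l\<in>{1..n}. real (c l)) * ?t c" by simp
  qed
  also have "\<dots> = (\<Sum>l\<in>{1..n}. \<Sum>c\<in>?L. real (c l) * ?t c)" by (rule sum.swap)
  also have "\<dots> = (\<Sum>l\<in>{1..n}. \<omega> l * weighted_level n (contract J l) \<omega> k)"
  proof (intro sum.cong refl)
    fix l assume l: "l \<in> {1..n}"
    have "(\<Sum>c\<in>?L. real (c l) * ?t c) = (\<Sum>c\<in>{c \<in> ?L. c l > 0}. real (c l) * ?t c)"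
      using fin by (intro sum.mono_neutral_right) auto
    also have "\<dots> = (\<Sum>a\<in>level n (contract J l) k. \<omega> l * ?t a)"
    proof (rule sum.reindex_bij_witness[where i = "\<lambda>a. inc a l" and j = "\<lambda>c. c(l := c l - 1)"])
      fix c assume c: "c \<in> {c \<in> ?L. c l > 0}"
      let ?a = "c(l := c l - 1)"
      show ca: "inc ?a l = c" by (rule inc_upd_cancel) (use c in simp)
      have "Suc (vsize n ?a) = Suc k" using vsize_inc[OF l, of ?a] c unfolding ca by (simp add: level_def)
      then show "?a \<in> level n (contract J l) k" using c ca by (simp add: level_def del: fun_upd_apply)
      have cl: "real (c l) = real (Suc (?a l))" using c by simp
      have "real (c l) * ?t c = real (c l) * ?t (inc ?a l)" unfolding ca ..
      also have "\<dots> = \<omega> l * ?t ?a" unfolding vweight_inc[OF l] vfact_inc[OF l] cl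
        by (simp del: of_nat_Suc fun_upd_apply)
      finally show "\<omega> l * ?t ?a = real (c l) * ?t c" ..
    next
      fix a assume "a \<in> level n (contract J l) k"
      then show "inc a l \<in> {c \<in> ?L. c l > 0}"
        using vsize_inc[OF l, of a] by (auto simp: level_def inc_apply)
      show "(inc a l)(l := inc a l l - 1) = a" by (auto simp: inc_def)
    qed
    finally show "(\<Sum>c\<in>?L. real (c l) * ?t c) = \<omega> l * weighted_level n (contract J l) \<omega> k"
      by (simp add: weighted_level_def sum_distrib_left)
  qed
  finally show ?thesis .
qed

lemma wsum_weighted_level:
  assumes "finite J" "J \<subseteq> nvecs n"
  shows "wsum {1..n} \<omega> k J = fact k * weighted_level n J \<omega> k"
  using assms
proof (induction k arbitrary: J)
  case 0
  have "level n J 0 = (if (\<lambda>_. 0) \<in> J then {\<lambda>_. 0} else {})"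
  proof -
    have "a = (\<lambda>_. 0)" if "a \<in> J" "vsize n a = 0" for a
    proof
      fix i show "a i = 0"
        using that "0.prems" by (cases "i \<in> {1..n}") (auto simp: vsize_def nvecs_def)
    qed
    moreover have "vsize n (\<lambda>_. 0) = 0" by (simp add: vsize_def)
    ultimately have "level n J 0 = J \<inter> {\<lambda>_. 0}" unfolding level_def by blast
    then show ?thesis by (simp only: Int_insert_right Int_empty_right)
  qed
  then show ?case by (simp add: weighted_level_def vweight_def vfact_def)
next
  case (Suc k)
  have "wsum {1..n} \<omega> (Suc k) J = (\<Sum>l\<in>{1..n}. \<omega> l * (fact k * weighted_level n (contract J l) \<omega> k))"
    unfolding wsum.simps
    by (intro sum.cong refl arg_cong2[where f = "(*)"] Suc.IH finite_contract contract_subset_nvecs Suc.prems)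
  also have "\<dots> = fact k * (real (Suc k) * weighted_level n J \<omega> (Suc k))"
    unfolding weighted_level_Suc[OF Suc.prems(1)] by (simp add: sum_distrib_left mult_ac)
  finally show ?case by (simp add: mult_ac)
qed

section \<open>Counting vectors and the polygirth\<close>

lemma card_vectors:
  shows "card {a \<in> nvecs n. vsize n a = k} = (n + k - 1) choose k" (is "card ?A = _")
    and "finite {a \<in> nvecs n. vsize n a = k}"
proof -
  let ?B = "{l :: nat list. length l = n \<and> sum_list l = k}"
  have bij: "bij_betw (\<lambda>a. map a [1..<Suc n]) ?A ?B"
  \<comment> \<open>Coordinates start at 1 and list positions at 0, hence the shift.\<close>
  proof (rule bij_betw_byWitness[where f' = "\<lambda>l i. if i \<in> {1..n} then l ! (i - 1) else 0"])
    show "\<forall>a\<in>?A. (\<lambda>i. if i \<in> {1..n} then map a [1..<Suc n] ! (i - 1) else 0) = a"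
      by (auto simp: nvecs_def fun_eq_iff nth_map simp del: upt_Suc)
    show "\<forall>l\<in>?B. map (\<lambda>i. if i \<in> {1..n} then l ! (i - 1) else 0) [1..<Suc n] = l"
      by (auto intro!: nth_equalityI simp del: upt_Suc)
    show "(\<lambda>a. map a [1..<Suc n]) ` ?A \<subseteq> ?B"
      by (auto simp: vsize_def interv_sum_list_conv_sum_set_nat atLeastLessThanSuc_atLeastAtMost simp del: upt_Suc)
    show "(\<lambda>l i. if i \<in> {1..n} then l ! (i - 1) else 0) ` ?B \<subseteq> ?A"
    proof (rule image_subsetI)
      fix l assume l: "l \<in> ?B"
      let ?a = "\<lambda>i. if i \<in> {1..n} then l ! (i - 1) else 0"
      have "vsize n ?a = (\<Sum>i\<in>{1..n}. l ! (i - 1))"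
        unfolding vsize_def by (intro sum.cong) auto
      also have "\<dots> = (\<Sum>i<n. l ! i)"
        by (rule sum.reindex_bij_witness[where i = Suc and j = "\<lambda>i. i - 1"]) auto
      also have "\<dots> = k" using l by (auto simp: sum_list_sum_nth atLeast0LessThan)
      finally show "?a \<in> ?A" by (simp add: nvecs_def)
    qed
  qed
  then have "card ?A = card ?B" by (rule bij_betw_same_card)
  then show "card ?A = (n + k - 1) choose k" by (simp add: card_length_sum_list add.commute)
  have "finite ?B"
  proof (rule finite_subset)
    show "?B \<subseteq> {l. set l \<subseteq> {..k} \<and> length l = n}" using member_le_sum_list by auto
  qed (simp add: finite_lists_length_eq)
  then show "finite ?A" using bij bij_betw_finite by blast
qed

lemma polygirth_greater_iff:
  assumes fin: "finite J" and J: "J \<subseteq> nvecs n" and n: "n \<ge> 1"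
  shows "polygirth n J > K \<longleftrightarrow> (\<forall>a\<in>nvecs n. vsize n a \<le> K \<longrightarrow> a \<in> J)"
proof -
  let ?P = "\<lambda>k. card (level n J k) < (n + k - 1) choose k"
  have full: "\<not> ?P k \<longleftrightarrow> (\<forall>a\<in>nvecs n. vsize n a = k \<longrightarrow> a \<in> J)" for k
  proof -
    let ?A = "{a \<in> nvecs n. vsize n a = k}"
    have sub: "level n J k \<subseteq> ?A" using J by (auto simp: level_def)
    have "\<not> ?P k \<longleftrightarrow> level n J k = ?A"
      using card_seteq[OF card_vectors(2) sub] by (auto simp: card_vectors(1) not_less)
    also have "\<dots> \<longleftrightarrow> (\<forall>a\<in>nvecs n. vsize n a = k \<longrightarrow> a \<in> J)"
      using sub by (auto simp: level_def)
    finally show ?thesis .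
  qed
  \<comment> \<open>Level \<open>N\<close> lies above all sizes in \<open>J\<close> and is empty,
    while the binomial is positive as \<open>n\<close> is at least 1; so the least index exists.
    Inserting 0 keeps \<open>Max\<close> defined for empty \<open>J\<close>.\<close>
  define N where "N = Suc (Max (insert 0 (vsize n ` J)))"
  have "vsize n a < N" if "a \<in> J" for a
    unfolding N_def less_Suc_eq_le using fin that by (intro Max_ge) auto
  then have "level n J N = {}" by (auto simp: level_def)
  then have "?P N" using n by simp
  then have "?P (polygirth n J)" unfolding polygirth_def by (rule LeastI)
  moreover have "\<not> ?P k" if "k < polygirth n J" for k
    using not_less_Least[of k ?P] that unfolding polygirth_def by blast
  ultimately have "polygirth n J > K \<longleftrightarrow> (\<forall>k\<le>K. \<not> ?P k)"
    by (meson le_less_trans not_less)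
  then show ?thesis unfolding full by auto
qed

section \<open>The theorem for discrete polymatroids\<close>

lemma polym_discrete_polymatroid:
  assumes "discrete_polymatroid n J" shows "polym {1..n} J"
proof -
  interpret discrete_polymatroid n J by (rule assms)
  have inc: "vadd a (unit_vec i) = inc a i" for a i
    by (auto simp: vadd_def unit_vec_def inc_def)
  show ?thesis
    unfolding polym_def
  proof (intro conjI ballI allI impI)
    fix a b assume a: "a \<in> J" "b \<le> a"
    have "b i = 0" if "i \<notin> {1..n}" for i
    proof -
      have "a i = 0" using that a(1) vectors by (auto simp: nvecs_def)
      then show ?thesis using le_funD[OF a(2), of i] by simp
    qed
    then have "b \<in> nvecs n" by (simp add: nvecs_def)
    with a show "b \<in> J" using hereditary by blast
  next
    fix a b assume "a \<in> J" "b \<in> J" "sum a {1..n} < sum b {1..n}"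
    then show "\<exists>i\<in>{1..n}. a i < b i \<and> inc a i \<in> J"
      using exchange[of a b] by (simp add: vsize_def inc)
  qed
qed

theorem theorem1p23:
  fixes n k :: nat and J :: "(nat \<Rightarrow> nat) set" and \<omega> :: "nat \<Rightarrow> real"
  assumes "discrete_polymatroid n J"
    and "nondegenerate n J"
    and "\<forall>i\<in>{1..n}. \<omega> i > 0"
    and "1 \<le> k"
    and "k < polymatroid_rank n J"
  shows "(weighted_level n J \<omega> k)\<^sup>2
           = (1 + 1 / real k) * weighted_level n J \<omega> (k - 1) * weighted_level n J \<omega> (k + 1)
         \<longleftrightarrow> polygirth n J > k + 1"
proof -
  interpret discrete_polymatroid n J by (rule assms)
  let ?E = "{1..n}"
  let ?w = "\<lambda>k. wsum ?E \<omega> k J"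
  have P: "polym ?E J" by (rule polym_discrete_polymatroid[OF assms(1)])
  have p: "\<And>i. i \<in> ?E \<Longrightarrow> \<omega> i > 0" using assms(3) by blast
  obtain m where m: "k = Suc m" using assms(4) by (cases k) auto
  have unit: "inc (\<lambda>_. 0) i = unit_vec i" for i by (auto simp: inc_def unit_vec_def)
  have nondeg: "inc (\<lambda>_. 0) i \<in> J" if "i \<in> ?E" for i
    using assms(2) that unfolding unit nondegenerate_def by blast
  have "polymatroid_rank n J \<in> vsize n ` J"
    unfolding polymatroid_rank_def using finite nonempty by (intro Max_in) auto
  then obtain b where b: "b \<in> J" "sum b ?E \<ge> m + 2"
    using assms(5) m by (auto simp: vsize_def)
  have ex: "\<exists>a\<in>J. sum a ?E = j" if "j \<le> m + 2" for j
    using vector_between[of ?E "\<lambda>_. 0" b j] polym_hereditary[OF P b(1)] b(2) that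
    by (auto simp: le_fun_def)
  have pos: "?w j > 0" if j: "j \<le> m + 2" for j
  proof -
    obtain a where "a \<in> J" "sum a ?E = j" using ex[OF j] by blast
    then show ?thesis using p by (intro wsum_pos[OF P]) (auto simp: less_imp_le)
  qed
  \<comment> \<open>Rank at least 2 excludes \<open>n = 0\<close>, where \<open>polygirth\<close> is
    unspecified.\<close>
  have n: "n \<ge> 1" using b(2) by (cases n) auto
  have supp: "a \<in> nvecs n \<longleftrightarrow> (\<forall>i. i \<notin> ?E \<longrightarrow> a i = 0)" for a
    by (auto simp: nvecs_def)
  have w: "?w j = fact j * weighted_level n J \<omega> j" for j
    by (rule wsum_weighted_level[OF finite vectors])
  have "(weighted_level n J \<omega> k)\<^sup>2
        = (1 + 1 / real k) * weighted_level n J \<omega> (k - 1) * weighted_level n J \<omega> (k + 1)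
      \<longleftrightarrow> (?w (Suc m))\<^sup>2 = ?w m * ?w (Suc (Suc m))" (is "?L \<longleftrightarrow> ?R")
  proof -
    let ?f = "(fact (Suc m))\<^sup>2 :: real"
    \<comment> \<open>The factor comes from
      \<open>(k - 1)! (k + 1)! = (1 + 1/k) (k!)^2\<close>.\<close>
    have "?w m * ?w (Suc (Suc m))
        = ?f * ((1 + 1 / real k) * weighted_level n J \<omega> (k - 1) * weighted_level n J \<omega> (k + 1))"
      unfolding w m by (simp add: power2_eq_square field_simps)
    moreover have "(?w (Suc m))\<^sup>2 = ?f * (weighted_level n J \<omega> k)\<^sup>2"
      unfolding w m by (simp only: power_mult_distrib)
    moreover have "?f \<noteq> 0" by simp
    ultimately show ?thesis by (metis mult_left_cancel)
  qed
  also have "?R \<longleftrightarrow> (\<forall>a\<in>nvecs n. vsize n a \<le> k + 1 \<longrightarrow> a \<in> J)"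
  proof
    assume eq: ?R
    \<comment> \<open>The index 0 lies outside \<open>{1..n}\<close> and serves as the free
      element.\<close>
    obtain c where
      c1: "\<And>a. a \<in> J \<Longrightarrow> sum a ?E = m \<Longrightarrow> (\<And>i. i \<notin> ?E \<Longrightarrow> a i = 0) \<Longrightarrow>
        c * (\<Sum>j\<in>?E. if inc a j \<in> J then \<omega> j else 0) = 1" and
      c2: "\<And>a i. a \<in> J \<Longrightarrow> sum a ?E = m \<Longrightarrow> (\<And>i. i \<notin> ?E \<Longrightarrow> a i = 0) \<Longrightarrow> i \<in> ?E \<Longrightarrow> inc a i \<in> J \<Longrightarrow>
        c * (\<Sum>j\<in>?E. if inc (inc a i) j \<in> J then \<omega> j else 0) = 1"
      using equality_local[OF P _ _ p eq pos, of 0] by auto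
    obtain a0 where a0: "a0 \<in> J" "sum a0 ?E = m" using ex[of m] by auto
    have a0s: "\<And>i. i \<notin> ?E \<Longrightarrow> a0 i = 0" using a0(1) vectors supp by blast
    show "\<forall>a\<in>nvecs n. vsize n a \<le> k + 1 \<longrightarrow> a \<in> J"
    proof (intro ballI impI)
      fix a assume a: "a \<in> nvecs n" "vsize n a \<le> k + 1"
      show "a \<in> J"
      proof (rule all_vectors_in_polym[OF P _ p nondeg a0 a0s c1 c2])
        show "sum a ?E \<le> m + 2" using a(2) m by (simp add: vsize_def)
        show "a i = 0" if "i \<notin> ?E" for i using a(1) supp that by blast
      qed simp_all
    qed
  next
    assume "\<forall>a\<in>nvecs n. vsize n a \<le> k + 1 \<longrightarrow> a \<in> J"
    then have "?w j = (sum \<omega> ?E) ^ j" if "j \<le> m + 2" for j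
      using that m by (intro wsum_full) (auto simp: supp vsize_def)
    then show ?R by (simp add: power2_eq_square del: wsum.simps)
  qed
  also have "\<dots> \<longleftrightarrow> polygirth n J > k + 1"
    by (rule polygirth_greater_iff[OF finite vectors n, symmetric])
  finally show ?thesis .
qed

end
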